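(* Let $(\mathfrak g,D)$ be a regular pre-LieDer pair and $(V,K,\tilde\rho,\tilde\mu)$ a fixed representation of it. Abelian extensions of $(\mathfrak g,D)$ by $(V,K)$ (inducing the given representation $(V,K,\tilde\rho,\tilde\mu)$) are classified by the second cohomology group $H^2(\mathfrak g,D;V,K,\tilde\rho,\tilde\mu)$. That is, sending an abelian extension with a section $s$ to the class of $(\theta,\xi)$, where $\theta(x,y)=s(x)\cdot_{\hat{\mathfrak g}}s(y)-s(x\cdot y)$ and $\xi(x)=\hat D(s(x))-s(D(x))$, gives a well-defined bijection (independent of $s$) between isomorphism classes of abelian extensions of $(\mathfrak g,D)$ by $(V,K)$ inducing the given representation and $H^2(\mathfrak g,D;V,K,\tilde\rho,\tilde\mu)$.
   Context: All vector spaces are over an algebraically closed field $\mathbb K$ of characteristic $0$. Pre-Lie algebra: a vector space $\mathfrak g$ with a bilinear product $\cdot$ such that $(x\cdot y)\cdot z-x\cdot(y\cdot z)=(y\cdot x)\cdot z-y\cdot(x\cdot z)$; $[x,y]_C=x\cdot y-y\cdot x$ is the bracket of the sub-adjacent Lie algebra $\mathfrak g^C$. A representation $(V;\tilde\rho,\tilde\mu)$ of it consists of a representation $\tilde\rho:\mathfrak g\to\mathfrak{gl}(V)$ of $\mathfrak g^C$ and a linear map $\tilde\mu:\mathfrak g\to\mathfrak{gl}(V)$ with $\tilde\mu(y)\tilde\mu(x)-\tilde\mu(x\cdot y)=\tilde\mu(y)\tilde\rho(x)-\tilde\rho(x)\tilde\mu(y)$. A regular pre-LieDer pair $(\mathfrak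 g,D)$ is a pre-Lie algebra with a linear map $D:\mathfrak g\to\mathfrak g$ satisfying $D(x\cdot y)=x\cdot D(y)+D(x)\cdot y$; morphisms are pre-Lie algebra morphisms commuting with these derivations. A representation $(V,K,\tilde\rho,\tilde\mu)$ of $(\mathfrak g,D)$ is a representation $(V;\tilde\rho,\tilde\mu)$ of the pre-Lie algebra $(\mathfrak g,\cdot)$ with a linear map $K:V\to V$ such that $K(\tilde\rho(x)u)=\tilde\rho(x)K(u)+\tilde\rho(D(x))u$ and $K(\tilde\mu(x)u)=\tilde\mu(x)K(u)+\tilde\mu(D(x))u$. Abelian extension of $(\mathfrak g,D)$ by $(V,K)$, where $V$ has zero product: a regular pre-LieDer pair $(\hat{\mathfrak g},\cdot_{\hat{\mathfrak g}},\hat D)$ with a short exact sequence $0\to V\xrightarrow{\iota}\hat{\mathfrak g}\xrightarrow{p}\mathfrak g\to0$ of morphisms of regular pre-LieDer pairs (so $\hat D\iota=\iota K$, $p\hat D=Dp$); $V$ is identified with $\iota(V)$. A section is a linear map $s:\mathfrak g\to\hat{\mathfrak g}$ with $p\circ s=\mathrm{Id}_{\mathfrak g}$. The induced representation is $\tilde\rho(x)(u)=s(x)\cdot_{\hat{\mathfrak g}}u$, $\tilde\mu(x)(u)=u\cdot_{\hat{\mathfrak g}}s(x)$; it does not depend on $s$. Two abelian extensions $\hat{\mathfrak g}_1,\hat{\mathfrak g}_2$ are isomorphic if there is an isomorphism $\zeta:\hat{\mathfrak g}_1\to\hat{\mathfrak g}_2$ of regular pre-LieDer pairs with $\zeta\circ\iota_1=\iota_2$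 and $p_2\circ\zeta=p_1$. Cohomology $H^n(\mathfrak g,D;V,K,\tilde\rho,\tilde\mu)$: it is the cohomology of the complex with $C^0=0$, $C^1=\mathrm{Hom}(\mathfrak g,V)$, $C^n=\mathrm{Hom}(\wedge^{n-1}\mathfrak g\otimes\mathfrak g,V)\oplus\mathrm{Hom}(\wedge^{n-2}\mathfrak g\otimes\mathfrak g,V)$ for $n\ge2$, and coboundary $\mathcal D_{(\tilde\rho,\tilde\mu)}(f,\theta)=(\mathrm d_{(\tilde\rho,\tilde\mu)}f,\mathrm d_{(\tilde\rho,\tilde\mu)}\theta+\Omega_{(\tilde\rho,\tilde\mu)}f)$ ($\theta=0$ for $n=1$), where for $f\in\mathrm{Hom}(\wedge^{n-1}\mathfrak g\otimes\mathfrak g,V)$ $$(\mathrm d_{(\tilde\rho,\tilde\mu)}f)(x_1,\dots,x_{n+1})=\sum_{i=1}^n(-1)^{i+1}\tilde\rho(x_i)f(x_1,\dots,\hat{x_i},\dots,x_{n+1})+\sum_{i=1}^n(-1)^{i+1}\tilde\mu(x_{n+1})f(x_1,\dots,\hat{x_i},\dots,x_n,x_i)$$ $$-\sum_{i=1}^n(-1)^{i+1}f(x_1,\dots,\hat{x_i},\dots,x_n,x_i\cdot x_{n+1})+\sum_{1\le i<j\le n}(-1)^{i+j}f([x_i,x_j]_C,x_1,\dots,\hat{x_i},\dots,\hat{x_j},\dots,x_{n+1}),$$ $$(\Omega_{(\tilde\rho,\tilde\mu)}f)(x_1,\dots,x_n)=(-1)^{n-2}\Big(\sum_{i=1}^nf(x_1,\dots,x_{i-1},D(x_i),x_{i+1},\dots,x_n)-K(f(x_1,\dots,x_n))\Big).$$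 *)

theory Defs
  imports "HOL-Algebra.Algebra"
begin

locale alg_closed_field_char_0 = algebraically_closed R for R (structure) +
  assumes char_0: "n > 0 \<Longrightarrow> add_pow R (n :: nat) \<one> \<noteq> \<zero>"

definition linear_map where
  "linear_map R M N f \<longleftrightarrow>
     f \<in> carrier M \<rightarrow> carrier N \<and>
     (\<forall>x \<in> carrier M. \<forall>y \<in> carrier M. f (x \<oplus>\<^bsub>M\<^esub> y) = f x \<oplus>\<^bsub>N\<^esub> f y) \<and>
     (\<forall>a \<in> carrier R. \<forall>x \<in> carrier M. f (a \<odot>\<^bsub>M\<^esub> x) = a \<odot>\<^bsub>N\<^esub> f x)"

(* The pre-Lie product is the mult field of the module record, which the library's module
   locale leaves unconstrained.  The record's one field carries no meaning here. *)
locale pre_lie_algebra = field R + module R G for R (structure) and G (structure) +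
  assumes product_linear_left: "y \<in> carrier G \<Longrightarrow> linear_map R G G (\<lambda>x. x \<otimes>\<^bsub>G\<^esub> y)"
    and product_linear_right: "x \<in> carrier G \<Longrightarrow> linear_map R G G (\<lambda>y. x \<otimes>\<^bsub>G\<^esub> y)"
    and left_symmetric:
      "\<lbrakk>x \<in> carrier G; y \<in> carrier G; z \<in> carrier G\<rbrakk> \<Longrightarrow>
         (x \<otimes>\<^bsub>G\<^esub> y) \<otimes>\<^bsub>G\<^esub> z \<ominus>\<^bsub>G\<^esub> x \<otimes>\<^bsub>G\<^esub> (y \<otimes>\<^bsub>G\<^esub> z)
         = (y \<otimes>\<^bsub>G\<^esub> x) \<otimes>\<^bsub>G\<^esub> z \<ominus>\<^bsub>G\<^esub> y \<otimes>\<^bsub>G\<^esub> (x \<otimes>\<^bsub>G\<^esub> z)"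

definition commutator where
  "commutator G x y = x \<otimes>\<^bsub>G\<^esub> y \<ominus>\<^bsub>G\<^esub> y \<otimes>\<^bsub>G\<^esub> x"

locale regular_preLieDer = pre_lie_algebra R G for R (structure) and G (structure) +
  fixes D
  assumes D_linear: "linear_map R G G D"
    and D_product: "\<lbrakk>x \<in> carrier G; y \<in> carrier G\<rbrakk> \<Longrightarrow>
      D (x \<otimes>\<^bsub>G\<^esub> y) = x \<otimes>\<^bsub>G\<^esub> D y \<oplus>\<^bsub>G\<^esub> D x \<otimes>\<^bsub>G\<^esub> y"

definition preLieDer_hom where
  "preLieDer_hom R G D H E f \<longleftrightarrow>
     linear_map R G H f \<and>
     (\<forall>x \<in> carrier G. \<forall>y \<in> carrier G. f (x \<otimes>\<^bsub>G\<^esub> y) = f x \<otimes>\<^bsub>H\<^esub> f y) \<and>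
     (\<forall>x \<in> carrier G. f (D x) = E (f x))"


subsection \<open>Representations\<close>

locale preLie_representation =
  pre_lie_algebra R G + V: module R V
  for R (structure) and G (structure) and V (structure) +
  fixes \<rho> \<mu>
  assumes \<rho>_linear: "u \<in> carrier V \<Longrightarrow> linear_map R G V (\<lambda>x. \<rho> x u)"
    and \<rho>_endo: "x \<in> carrier G \<Longrightarrow> linear_map R V V (\<rho> x)"
    and \<mu>_linear: "u \<in> carrier V \<Longrightarrow> linear_map R G V (\<lambda>x. \<mu> x u)"
    and \<mu>_endo: "x \<in> carrier G \<Longrightarrow> linear_map R V V (\<mu> x)"
    and \<rho>_commutator:
      "\<lbrakk>x \<in> carrier G; y \<in> carrier G; u \<in> carrier V\<rbrakk> \<Longrightarrow>
         \<rho> (commutator G x y) u = \<rho> x (\<rho> y u) \<ominus>\<^bsub>V\<^esub> \<rho> y (\<rho> x u)"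
    and \<mu>_product:
      "\<lbrakk>x \<in> carrier G; y \<in> carrier G; u \<in> carrier V\<rbrakk> \<Longrightarrow>
         \<mu> y (\<mu> x u) \<ominus>\<^bsub>V\<^esub> \<mu> (x \<otimes>\<^bsub>G\<^esub> y) u = \<mu> y (\<rho> x u) \<ominus>\<^bsub>V\<^esub> \<rho> x (\<mu> y u)"

locale preLieDer_representation =
  regular_preLieDer R G D + preLie_representation R G V \<rho> \<mu>
  for R (structure) and G (structure) and D and V (structure) and K and \<rho> and \<mu> +
  assumes K_linear: "linear_map R V V K"
    and K_\<rho>: "\<lbrakk>x \<in> carrier G; u \<in> carrier V\<rbrakk> \<Longrightarrow> K (\<rho> x u) = \<rho> x (K u) \<oplus>\<^bsub>V\<^esub> \<rho> (D x) u"
    and K_\<mu>: "\<lbrakk>x \<in> carrier G; u \<in> carrier V\<rbrakk> \<Longrightarrow> K (\<mu> x u) = \<mu> x (K u) \<oplus>\<^bsub>V\<^esub> \<mu> (D x) u"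


subsection \<open>Cohomology\<close>

definition tuples where
  "tuples G n = {xs. length xs = n \<and> set xs \<subseteq> carrier G}"

(* Hom(Wedge^(n-1) G (x) G, V), as multilinear functions of n arguments that are alternating in
   the first n - 1 of them; a function is normalised to be undefined off the n-tuples.
   For n = 0 the space is zero by convention, so that C^0 and the second summand of C^1 vanish. *)
definition hom_space where
  "hom_space R G V n =
     (if n = 0 then {\<lambda>xs \<in> tuples G n. \<zero>\<^bsub>V\<^esub>}
      else {f \<in> extensional (tuples G n).
              (\<forall>xs \<in> tuples G n. \<forall>i < n. linear_map R G V (\<lambda>x. f (xs[i := x]))) \<and>
              (\<forall>xs \<in> tuples G n. \<forall>i j. i < j \<and> j < n - 1 \<and> xs ! i = xs ! j \<longrightarrow> f xs = \<zero>\<^bsub>V\<^esub>)})"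

definition hom_group where
  "hom_group R G V n =
     \<lparr>carrier = hom_space R G V n,
      monoid.mult = (\<lambda>f g. \<lambda>xs \<in> tuples G n. f xs \<oplus>\<^bsub>V\<^esub> g xs),
      one = (\<lambda>xs \<in> tuples G n. \<zero>\<^bsub>V\<^esub>)\<rparr>"

(* The additive group C^n. *)
definition cochains where
  "cochains R G V n = hom_group R G V n \<times>\<times> hom_group R G V (n - 1)"

definition sgn_smult where
  "sgn_smult R V i v = ((\<ominus>\<^bsub>R\<^esub> \<one>\<^bsub>R\<^esub>) [^]\<^bsub>R\<^esub> (i :: nat)) \<odot>\<^bsub>V\<^esub> v"

(* Arguments are numbered from 0, so x_(i+1) is xs ! i and the signs (-1)^(i+1), (-1)^(i+j) of
   the formula with indices from 1 become (-1)^i, (-1)^(i+j).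
   nths xs (- I) is xs with the entries at positions in I removed. *)
definition d where
  "d R G V \<rho> \<mu> n f = (\<lambda>xs \<in> tuples G (n + 1).
     (\<Oplus>\<^bsub>V\<^esub>i\<in>{..<n}. sgn_smult R V i (\<rho> (xs ! i) (f (nths xs (- {i})))))
     \<oplus>\<^bsub>V\<^esub> (\<Oplus>\<^bsub>V\<^esub>i\<in>{..<n}. sgn_smult R V i (\<mu> (xs ! n) (f (nths xs (- {i, n}) @ [xs ! i]))))
     \<ominus>\<^bsub>V\<^esub> (\<Oplus>\<^bsub>V\<^esub>i\<in>{..<n}. sgn_smult R V i (f (nths xs (- {i, n}) @ [xs ! i \<otimes>\<^bsub>G\<^esub> xs ! n])))
     \<oplus>\<^bsub>V\<^esub> finsum V (\<lambda>(i, j).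
           sgn_smult R V (i + j) (f (commutator G (xs ! i) (xs ! j) # nths xs (- {i, j}))))
         {(i, j). i < j \<and> j < n})"

(* The sign (-1)^(n-2) is written (-1)^n, since n - 2 truncates for n = 1. *)
definition Omega where
  "Omega R G D V K n f = (\<lambda>xs \<in> tuples G n.
     sgn_smult R V n ((\<Oplus>\<^bsub>V\<^esub>i\<in>{..<n}. f (xs[i := D (xs ! i)])) \<ominus>\<^bsub>V\<^esub> K (f xs)))"

definition coboundary where
  "coboundary R G D V K \<rho> \<mu> n = (\<lambda>(f, \<theta>).
     if n = 0 then \<one>\<^bsub>cochains R G V 1\<^esub>
     else (d R G V \<rho> \<mu> n f,
           \<lambda>xs \<in> tuples G n. d R G V \<rho> \<mu> (n - 1) \<theta> xs \<oplus>\<^bsub>V\<^esub> Omega R G D V K n f xs))"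

definition cocycles where
  "cocycles R G D V K \<rho> \<mu> n =
     kernel (cochains R G V n) (cochains R G V (n + 1)) (coboundary R G D V K \<rho> \<mu> n)"

definition coboundaries where
  "coboundaries R G D V K \<rho> \<mu> n =
     (if n = 0 then {\<one>\<^bsub>cochains R G V 0\<^esub>}
      else coboundary R G D V K \<rho> \<mu> (n - 1) ` carrier (cochains R G V (n - 1)))"

definition cocycle_group where
  "cocycle_group R G D V K \<rho> \<mu> n = (cochains R G V n)\<lparr>carrier := cocycles R G D V K \<rho> \<mu> n\<rparr>"

definition cohomology where
  "cohomology R G D V K \<rho> \<mu> n =
     cocycle_group R G D V K \<rho> \<mu> n Mod coboundaries R G D V K \<rho> \<mu> n"

definition cohomology_class where
  "cohomology_class R G D V K \<rho> \<mu> n c =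
     coboundaries R G D V K \<rho> \<mu> n #>\<^bsub>cocycle_group R G D V K \<rho> \<mu> n\<^esub> c"


subsection \<open>Abelian extensions\<close>

(* 'u is a universe: the underlying set of an extension is any subset of 'u that is the carrier
   of a module.  Every extension of G by V is equipotent to carrier G x carrier V, so a universe
   into which this product injects contains a copy of every extension, and any family of
   extensions can be compared inside a sufficiently large 'u. *)
record ('k, 'u, 'g, 'v) extension =
  total :: "('k, 'u) module"
  der :: "'u \<Rightarrow> 'u"
  incl :: "'v \<Rightarrow> 'u"
  proj :: "'u \<Rightarrow> 'g"

definition zero_product :: "('k, 'v) module \<Rightarrow> ('k, 'v) module" where
  "zero_product V = V\<lparr>monoid.mult := \<lambda>u v. \<zero>\<^bsub>V\<^esub>\<rparr>"

definition abelian_extension ::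
  "'k ring \<Rightarrow> ('k, 'g) module \<Rightarrow> ('g \<Rightarrow> 'g) \<Rightarrow> ('k, 'v) module \<Rightarrow> ('v \<Rightarrow> 'v) \<Rightarrow>
     ('k, 'u, 'g, 'v) extension \<Rightarrow> bool" where
  "abelian_extension R G D V K E \<longleftrightarrow>
     regular_preLieDer R (total E) (der E) \<and>
     preLieDer_hom R (zero_product V) K (total E) (der E) (incl E) \<and>
     preLieDer_hom R (total E) (der E) G D (proj E) \<and>
     inj_on (incl E) (carrier V) \<and>
     incl E ` carrier V = {e \<in> carrier (total E). proj E e = \<zero>\<^bsub>G\<^esub>} \<and>
     proj E ` carrier (total E) = carrier G"

definition linear_section ::
  "'k ring \<Rightarrow> ('k, 'g) module \<Rightarrow> ('k, 'u, 'g, 'v) extension \<Rightarrow> ('g \<Rightarrow> 'u) \<Rightarrow> bool" where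
  "linear_section R G E s \<longleftrightarrow>
     linear_map R G (total E) s \<and> (\<forall>x \<in> carrier G. proj E (s x) = x)"

definition induces ::
  "'k ring \<Rightarrow> ('k, 'g) module \<Rightarrow> ('k, 'v) module \<Rightarrow> ('g \<Rightarrow> 'v \<Rightarrow> 'v) \<Rightarrow> ('g \<Rightarrow> 'v \<Rightarrow> 'v) \<Rightarrow>
     ('k, 'u, 'g, 'v) extension \<Rightarrow> bool" where
  "induces R G V \<rho> \<mu> E \<longleftrightarrow>
     (\<forall>s. linear_section R G E s \<longrightarrow>
        (\<forall>x \<in> carrier G. \<forall>u \<in> carrier V.
           incl E (\<rho> x u) = s x \<otimes>\<^bsub>total E\<^esub> incl E u \<and>
           incl E (\<mu> x u) = incl E u \<otimes>\<^bsub>total E\<^esub> s x))"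

definition extensions ::
  "'k ring \<Rightarrow> ('k, 'g) module \<Rightarrow> ('g \<Rightarrow> 'g) \<Rightarrow> ('k, 'v) module \<Rightarrow> ('v \<Rightarrow> 'v) \<Rightarrow>
     ('g \<Rightarrow> 'v \<Rightarrow> 'v) \<Rightarrow> ('g \<Rightarrow> 'v \<Rightarrow> 'v) \<Rightarrow> ('k, 'u, 'g, 'v) extension set" where
  "extensions R G D V K \<rho> \<mu> =
     {E. abelian_extension R G D V K E \<and> induces R G V \<rho> \<mu> E}"

definition extension_iso ::
  "'k ring \<Rightarrow> ('k, 'v) module \<Rightarrow> ('k, 'u, 'g, 'v) extension \<Rightarrow> ('k, 'u, 'g, 'v) extension \<Rightarrow>
     ('u \<Rightarrow> 'u) \<Rightarrow> bool" where
  "extension_iso R V E F \<zeta> \<longleftrightarrow>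
     preLieDer_hom R (total E) (der E) (total F) (der F) \<zeta> \<and>
     bij_betw \<zeta> (carrier (total E)) (carrier (total F)) \<and>
     (\<forall>u \<in> carrier V. \<zeta> (incl E u) = incl F u) \<and>
     (\<forall>e \<in> carrier (total E). proj F (\<zeta> e) = proj E e)"

definition iso_rel ::
  "'k ring \<Rightarrow> ('k, 'g) module \<Rightarrow> ('g \<Rightarrow> 'g) \<Rightarrow> ('k, 'v) module \<Rightarrow> ('v \<Rightarrow> 'v) \<Rightarrow>
     ('g \<Rightarrow> 'v \<Rightarrow> 'v) \<Rightarrow> ('g \<Rightarrow> 'v \<Rightarrow> 'v) \<Rightarrow> ('k, 'u, 'g, 'v) extension rel" where
  "iso_rel R G D V K \<rho> \<mu> =
     {(E, F). E \<in> extensions R G D V K \<rho> \<mu> \<and> F \<in> extensions R G D V K \<rho> \<mu> \<and>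
              (\<exists>\<zeta>. extension_iso R V E F \<zeta>)}"

(* The pair (theta, xi) attached to a section.  The values s x . s y - s (x . y) and
   D^ (s x) - s (D x) lie in the image of V and are pulled back along the inclusion. *)
definition section_cochain ::
  "('k, 'g) module \<Rightarrow> ('g \<Rightarrow> 'g) \<Rightarrow> ('k, 'v) module \<Rightarrow> ('k, 'u, 'g, 'v) extension \<Rightarrow>
     ('g \<Rightarrow> 'u) \<Rightarrow> ('g list \<Rightarrow> 'v) \<times> ('g list \<Rightarrow> 'v)" where
  "section_cochain G D V E s =
     (\<lambda>xs \<in> tuples G 2. inv_into (carrier V) (incl E)
        (s (xs ! 0) \<otimes>\<^bsub>total E\<^esub> s (xs ! 1) \<ominus>\<^bsub>total E\<^esub> s (xs ! 0 \<otimes>\<^bsub>G\<^esub> xs ! 1)),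
      \<lambda>xs \<in> tuples G 1. inv_into (carrier V) (incl E)
        (der E (s (xs ! 0)) \<ominus>\<^bsub>total E\<^esub> s (D (xs ! 0))))"

end

theory Submission
  imports Defs
begin

text \<open>
  Given a pair \<open>(f, \<theta>)\<close> of cochains of degree 2, twist the semidirect product on
  \<open>G \<times> V\<close> by adding \<open>f [x, y]\<close> to the \<open>V\<close>-component of \<open>(x, u) \<cdot> (y, v)\<close> and \<open>\<theta> [x]\<close> to that of the
  derivation. The result is a regular pre-LieDer pair exactly when \<open>(f, \<theta>)\<close> is a cocycle.
  A section \<open>s\<close> of an extension \<open>E\<close> makes \<open>(x, u) \<mapsto> s x + u\<close> an isomorphism from the twisted
  product by the cochain of \<open>s\<close> onto \<open>E\<close>; so that cochain is a cocycle, and it determines \<open>E\<close> up to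
  isomorphism. Two sections differ by a linear map \<open>\<phi> : G \<rightarrow> V\<close>, which changes the cochain
  by the coboundary of \<open>\<phi>\<close>. Sections exist because vector spaces have complements.
\<close>

section \<open>Abelian groups\<close>

text \<open>The cocycle equations are the pre-Lie identity and the derivation rule of the twisted
  product read on pairs \<open>(x, 0)\<close>; on general pairs the remaining terms are absorbed by
  the axioms of a representation. Hence no associator is ever expanded inside an extension: the
  axioms are equations, so they pull back along any injective map that respects the operations. This
  serves once to transfer them from an extension to the twisted product of a section, and once to
  copy a twisted product into the universe \<open>'u\<close>, where the underlying set of an
  extension has to live. The obstacle in comparing extensions is that cohomologous cochains can give
  different twisted products. It is removed by moving the section: if two cochains differ by the
  coboundary of \<phi>, adding \<phi> to one of the sections makes the cochains equal on the nose,
  and both extensions become images of one and the same twisted product. Isomorphism thereby turns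
  into equality of one invariant, from which the equivalence relation and the injectivity follow
  formally.\<close>

lemma (in abelian_group) minus_closed_eq_iff:
  assumes "a \<in> carrier G" "b \<in> carrier G" "c \<in> carrier G"
  shows "a \<ominus> b = c \<longleftrightarrow> a = c \<oplus> b"
  using assms by (metis add.inv_solve_right minus_eq)

lemma (in abelian_group) minus_eq_minus_iff:
  assumes "a \<in> carrier G" "b \<in> carrier G" "c \<in> carrier G" "e \<in> carrier G"
  shows "a \<ominus> b = c \<ominus> e \<longleftrightarrow> a \<oplus> e = c \<oplus> b"
proof -
  have "a \<ominus> b = c \<ominus> e \<longleftrightarrow> a = c \<ominus> e \<oplus> b"
    using assms by (intro minus_closed_eq_iff) simp_all
  also have "c \<ominus> e \<oplus> b = c \<oplus> b \<ominus> e"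
    using assms by (simp add: minus_eq a_ac)
  also have "a = c \<oplus> b \<ominus> e \<longleftrightarrow> a \<oplus> e = c \<oplus> b"
    using assms minus_closed_eq_iff[of "c \<oplus> b" e a] by auto
  finally show ?thesis .
qed

lemma (in abelian_group) add_minus_cancel_right:
  assumes "a \<in> carrier G" "b \<in> carrier G"
  shows "a \<ominus> b \<oplus> b = a" "a \<oplus> b \<ominus> b = a"
  using assms by (simp_all add: minus_eq a_assoc l_neg r_neg)

lemma (in abelian_group) minus_eq_zero_iff:
  assumes "a \<in> carrier G" "b \<in> carrier G"
  shows "a \<ominus> b = \<zero> \<longleftrightarrow> a = b"
  using assms minus_closed_eq_iff[of a b \<zero>] by simp

text \<open>Bridges two shapes of the first cocycle equation. The left side lists the terms in the
  order of \<open>d\<close> in degree 2; on the right, \<open>k\<close>, \<open>e\<close>,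
  \<open>h\<close>, \<open>a\<close> are the terms of the associator of x, y, z, and
  \<open>l\<close>, \<open>c\<close>, \<open>g\<close>, \<open>b\<close> those with x and y
  exchanged.\<close>

lemma (in abelian_group) associator_arith:
  assumes "a \<in> carrier G" "b \<in> carrier G" "c \<in> carrier G" "e \<in> carrier G"
    "g \<in> carrier G" "h \<in> carrier G" "k \<in> carrier G" "l \<in> carrier G"
  shows "(a \<oplus> \<ominus> b) \<oplus> (c \<oplus> \<ominus> e) \<ominus> (g \<oplus> \<ominus> h) \<oplus> \<ominus> (k \<ominus> l) = \<zero> \<longleftrightarrow>
    (k \<oplus> e) \<ominus> (h \<oplus> a) = (l \<oplus> c) \<ominus> (g \<oplus> b)"
proof -
  have "(a \<oplus> \<ominus> b) \<oplus> (c \<oplus> \<ominus> e) \<ominus> (g \<oplus> \<ominus> h) \<oplus> \<ominus> (k \<ominus> l)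
      = ((l \<oplus> c) \<oplus> (h \<oplus> a)) \<ominus> ((k \<oplus> e) \<oplus> (g \<oplus> b))"
    using assms by (simp add: minus_eq minus_add a_ac)
  then show ?thesis
    using assms by (auto simp: minus_eq_zero_iff minus_eq_minus_iff)
qed

text \<open>Same purpose for the second equation: \<open>a\<close>, \<open>b\<close>,
  \<open>c\<close> come from \<open>d\<close> in degree 1 and \<open>e\<close>, \<open>g\<close>,
  \<open>h\<close> from \<open>Omega\<close> in degree 2. The right side is the Leibniz rule written
  without subtraction.\<close>

lemma (in abelian_group) derivation_arith:
  assumes "a \<in> carrier G" "b \<in> carrier G" "c \<in> carrier G" "e \<in> carrier G"
    "g \<in> carrier G" "h \<in> carrier G"
  shows "a \<oplus> b \<ominus> c \<oplus> (e \<oplus> g \<ominus> h) = \<zero> \<longleftrightarrow> a \<oplus> b \<oplus> (e \<oplus> g) = c \<oplus> h"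
proof -
  have "a \<oplus> b \<ominus> c \<oplus> (e \<oplus> g \<ominus> h) = (a \<oplus> b \<oplus> (e \<oplus> g)) \<ominus> (c \<oplus> h)"
    using assms by (simp add: minus_eq minus_add a_ac)
  then show ?thesis
    using assms by (simp add: minus_eq_zero_iff)
qed

text \<open>Sorts the V-component of the associator of (x, u), (y, v), (z, w) by origin: the cochain
  terms, then the terms in w, then those in v, then those in u. Each group is governed by its own
  axiom.\<close>

lemma (in abelian_group) twisted_associator_arith:
  assumes "k \<in> carrier G" "l \<in> carrier G" "m \<in> carrier G" "n \<in> carrier G" "p \<in> carrier G"
    "h \<in> carrier G" "r \<in> carrier G" "s \<in> carrier G" "t \<in> carrier G" "q \<in> carrier G"
  shows "(k \<oplus> l \<oplus> (m \<oplus> n \<oplus> p)) \<ominus> (h \<oplus> (r \<oplus> s \<oplus> t) \<oplus> q) =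
    ((k \<oplus> m) \<ominus> (h \<oplus> r)) \<oplus> (l \<ominus> s) \<oplus> ((n \<ominus> t) \<oplus> (p \<ominus> q))"
  using assms by (simp add: minus_eq minus_add a_ac)


section \<open>Linear maps\<close>

context
  fixes R :: "('a, 'r) ring_scheme" and M :: "('a, 'm, 'mm) module_scheme"
    and N :: "('a, 'n, 'nn) module_scheme" and f
  assumes f: "linear_map R M N f"
begin

lemma linear_map_closed: "x \<in> carrier M \<Longrightarrow> f x \<in> carrier N"
  using f by (auto simp: linear_map_def)

lemma linear_map_add:
  "x \<in> carrier M \<Longrightarrow> y \<in> carrier M \<Longrightarrow> f (x \<oplus>\<^bsub>M\<^esub> y) = f x \<oplus>\<^bsub>N\<^esub> f y"
  using f by (auto simp: linear_map_def)

lemma linear_map_smult: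
  "a \<in> carrier R \<Longrightarrow> x \<in> carrier M \<Longrightarrow> f (a \<odot>\<^bsub>M\<^esub> x) = a \<odot>\<^bsub>N\<^esub> f x"
  using f by (auto simp: linear_map_def)

lemma linear_map_zero:
  assumes "module R M" "module R N"
  shows "f \<zero>\<^bsub>M\<^esub> = \<zero>\<^bsub>N\<^esub>"
proof -
  interpret M: module R M by fact
  interpret N: module R N by fact
  show ?thesis
    using linear_map_smult[of "\<zero>\<^bsub>R\<^esub>" "\<zero>\<^bsub>M\<^esub>"] linear_map_closed[of "\<zero>\<^bsub>M\<^esub>"] by simp
qed

lemma linear_map_neg:
  assumes "module R M" "module R N" "x \<in> carrier M"
  shows "f (\<ominus>\<^bsub>M\<^esub> x) = \<ominus>\<^bsub>N\<^esub> f x"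
proof -
  interpret M: module R M by fact
  interpret N: module R N by fact
  have "f ((\<ominus>\<^bsub>R\<^esub> \<one>\<^bsub>R\<^esub>) \<odot>\<^bsub>M\<^esub> x) = (\<ominus>\<^bsub>R\<^esub> \<one>\<^bsub>R\<^esub>) \<odot>\<^bsub>N\<^esub> f x"
    using assms by (simp add: linear_map_smult)
  then show ?thesis
    using assms by (simp add: linear_map_closed M.smult_l_minus N.smult_l_minus)
qed

lemma linear_map_minus:
  assumes "module R M" "module R N" "x \<in> carrier M" "y \<in> carrier M"
  shows "f (x \<ominus>\<^bsub>M\<^esub> y) = f x \<ominus>\<^bsub>N\<^esub> f y"
proof -
  interpret M: module R M by fact
  show ?thesis
    using assms by (simp add: a_minus_def linear_map_add linear_map_neg)
qed

end

lemma linear_mapI: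
  assumes "\<And>x. x \<in> carrier M \<Longrightarrow> f x \<in> carrier N"
    and "\<And>x y. x \<in> carrier M \<Longrightarrow> y \<in> carrier M \<Longrightarrow> f (x \<oplus>\<^bsub>M\<^esub> y) = f x \<oplus>\<^bsub>N\<^esub> f y"
    and "\<And>a x. a \<in> carrier R \<Longrightarrow> x \<in> carrier M \<Longrightarrow> f (a \<odot>\<^bsub>M\<^esub> x) = a \<odot>\<^bsub>N\<^esub> f x"
  shows "linear_map R M N f"
  using assms by (auto simp: linear_map_def)

text \<open>Picking arbitrary preimages would not be linear. Picking them in a subspace
  \<open>W\<close> on which \<open>f\<close> is bijective leaves only one choice, and linearity then
  follows from uniqueness, since \<open>W\<close> is closed under the operations. The lemma is
  applied to the projection of an extension.\<close>

lemma linear_map_right_inverse: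
  assumes "field R" and M: "module R M" and N: "module R N"
    and f: "linear_map R M N f" and surj: "f ` carrier M = carrier N"
  shows "\<exists>s. linear_map R N M s \<and> (\<forall>x \<in> carrier N. f (s x) = x)"
proof -
  interpret R: field R by fact
  interpret M: module R M by fact
  interpret N: module R N by fact
  note lin = linear_map_closed[OF f] linear_map_add[OF f] linear_map_smult[OF f]
    linear_map_zero[OF f M N] linear_map_neg[OF f M N]
  \<comment> \<open>A maximal subspace meeting the kernel trivially is a complement of the kernel.\<close>
  define A where "A = {W. submodule W R M \<and> (\<forall>w\<in>W. f w = \<zero>\<^bsub>N\<^esub> \<longrightarrow> w = \<zero>\<^bsub>M\<^esub>)}"
  note sub = M.submoduleE
  have zero: "\<zero>\<^bsub>M\<^esub> \<in> W" if "submodule W R M" for W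
    using subgroup.one_closed[OF submodule.axioms(1)[OF that]] by simp
  have "\<exists>W\<in>A. \<forall>L\<in>A. W \<subseteq> L \<longrightarrow> L = W"
  proof (rule subset_Zorn_nonempty)
    have "submodule {\<zero>\<^bsub>M\<^esub>} R M"
      by (rule M.submoduleI) auto
    then have "{\<zero>\<^bsub>M\<^esub>} \<in> A"
      by (simp add: A_def)
    then show "A \<noteq> {}"
      by blast
    fix C assume C: "C \<noteq> {}" "subset.chain A C"
    then have CA: "submodule W R M" "\<forall>w\<in>W. f w = \<zero>\<^bsub>N\<^esub> \<longrightarrow> w = \<zero>\<^bsub>M\<^esub>" if "W \<in> C" for W
    proof -
      have "W \<in> A"
        using C(2) that by (meson subset.chain_def subsetD)
      then show "submodule W R M" "\<forall>w\<in>W. f w = \<zero>\<^bsub>N\<^esub> \<longrightarrow> w = \<zero>\<^bsub>M\<^esub>"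
        by (simp_all add: A_def)
    qed
    have "submodule (\<Union>C) R M"
    proof (rule M.submoduleI)
      fix a b assume "a \<in> \<Union>C" "b \<in> \<Union>C"
      then obtain L Y where XY: "a \<in> L" "L \<in> C" "b \<in> Y" "Y \<in> C" by blast
      have "L \<subseteq> Y \<or> Y \<subseteq> L"
        using C(2) XY by (simp add: subset_chain_def)
      then obtain Z where "Z \<in> C" "a \<in> Z" "b \<in> Z"
        using XY by blast
      then show "a \<oplus>\<^bsub>M\<^esub> b \<in> \<Union>C"
        using sub(5)[OF CA(1)] by blast
    next
      show "\<Union>C \<subseteq> carrier M"
        using sub(1)[OF CA(1)] by blast
      show "\<zero>\<^bsub>M\<^esub> \<in> \<Union>C"
        using zero[OF CA(1)] C(1) by blast
      show "\<ominus>\<^bsub>M\<^esub> a \<in> \<Union>C" if "a \<in> \<Union>C" for a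
        using sub(3)[OF CA(1)] that by blast
      show "a \<odot>\<^bsub>M\<^esub> x \<in> \<Union>C" if "a \<in> carrier R" "x \<in> \<Union>C" for a x
        using sub(4)[OF CA(1)] that by blast
    qed
    then show "\<Union>C \<in> A"
      using CA(2) by (auto simp: A_def)
  qed
  then obtain W where "W \<in> A" and max: "\<And>L. L \<in> A \<Longrightarrow> W \<subseteq> L \<Longrightarrow> L = W"
    by metis
  then have W: "submodule W R M" and ker: "\<And>w. w \<in> W \<Longrightarrow> f w = \<zero>\<^bsub>N\<^esub> \<Longrightarrow> w = \<zero>\<^bsub>M\<^esub>"
    by (simp_all add: A_def)
  note W_sub = sub[OF W] zero[OF W]
  have WM: "w \<in> carrier M" if "w \<in> W" for w
    using that W_sub(1) by blast
  have onto: "\<exists>w\<in>W. f w = x" if x: "x \<in> carrier N" for x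
  proof (rule ccontr)
    assume none: "\<not> (\<exists>w\<in>W. f w = x)"
    obtain e where e: "e \<in> carrier M" "f e = x"
      using surj x by (metis imageE)
    \<comment> \<open>If x is missed, a preimage \<open>e\<close> of x can be adjoined to
      \<open>W\<close>. The larger space still meets the kernel trivially: a relation
      \<open>f w + a x = 0\<close> with a nonzero would make x the image of
      \<open>inv a \<odot> (- w)\<close>, which lies in \<open>W\<close>. Maximality then puts
      \<open>e\<close> into \<open>W\<close>, a contradiction.\<close>
    define L where "L = {w \<oplus>\<^bsub>M\<^esub> a \<odot>\<^bsub>M\<^esub> e | w a. w \<in> W \<and> a \<in> carrier R}"
    have "submodule L R M"
    proof (rule M.submoduleI)
      show "L \<subseteq> carrier M"
        using WM e by (auto simp: L_def)
      show "\<zero>\<^bsub>M\<^esub> \<in> L"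
        unfolding L_def using W_sub(7) e
        by (intro CollectI exI[of _ "\<zero>\<^bsub>M\<^esub>"] exI[of _ "\<zero>\<^bsub>R\<^esub>"]) simp
    next
      fix u assume "u \<in> L"
      then obtain w a where "u = w \<oplus>\<^bsub>M\<^esub> a \<odot>\<^bsub>M\<^esub> e" "w \<in> W" "a \<in> carrier R"
        by (auto simp: L_def)
      then show "\<ominus>\<^bsub>M\<^esub> u \<in> L"
        unfolding L_def using e WM W_sub(3)
        by (intro CollectI exI[of _ "\<ominus>\<^bsub>M\<^esub> w"] exI[of _ "\<ominus>\<^bsub>R\<^esub> a"])
          (simp add: M.minus_add M.smult_l_minus)
    next
      fix u v assume "u \<in> L" "v \<in> L"
      then obtain w a w' a' where "u = w \<oplus>\<^bsub>M\<^esub> a \<odot>\<^bsub>M\<^esub> e" "w \<in> W" "a \<in> carrier R"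
        "v = w' \<oplus>\<^bsub>M\<^esub> a' \<odot>\<^bsub>M\<^esub> e" "w' \<in> W" "a' \<in> carrier R"
        by (auto simp: L_def)
      then show "u \<oplus>\<^bsub>M\<^esub> v \<in> L"
        unfolding L_def using e WM W_sub(5)
        by (intro CollectI exI[of _ "w \<oplus>\<^bsub>M\<^esub> w'"] exI[of _ "a \<oplus>\<^bsub>R\<^esub> a'"])
          (simp add: M.smult_l_distr M.M.a_ac)
    next
      fix b u assume "b \<in> carrier R" "u \<in> L"
      moreover then obtain w a where "u = w \<oplus>\<^bsub>M\<^esub> a \<odot>\<^bsub>M\<^esub> e" "w \<in> W" "a \<in> carrier R"
        by (auto simp: L_def)
      ultimately show "b \<odot>\<^bsub>M\<^esub> u \<in> L"
        unfolding L_def using e WM W_sub(4)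
        by (intro CollectI exI[of _ "b \<odot>\<^bsub>M\<^esub> w"] exI[of _ "b \<otimes>\<^bsub>R\<^esub> a"])
          (simp add: M.smult_r_distr M.smult_assoc1)
    qed
    moreover have "w \<oplus>\<^bsub>M\<^esub> a \<odot>\<^bsub>M\<^esub> e = \<zero>\<^bsub>M\<^esub>"
      if w: "w \<in> W" and a: "a \<in> carrier R" and eq: "f (w \<oplus>\<^bsub>M\<^esub> a \<odot>\<^bsub>M\<^esub> e) = \<zero>\<^bsub>N\<^esub>" for w a
    proof (cases "a = \<zero>\<^bsub>R\<^esub>")
      case True
      then show ?thesis
        using ker[OF w] eq e w WM by simp
    next
      case False
      then have a': "inv\<^bsub>R\<^esub> a \<in> carrier R" "inv\<^bsub>R\<^esub> a \<otimes>\<^bsub>R\<^esub> a = \<one>\<^bsub>R\<^esub>"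
        using a R.field_Units by auto
      have "f w \<oplus>\<^bsub>N\<^esub> a \<odot>\<^bsub>N\<^esub> x = \<zero>\<^bsub>N\<^esub>"
        using eq w a e WM by (simp add: lin)
      then have "a \<odot>\<^bsub>N\<^esub> x = \<ominus>\<^bsub>N\<^esub> f w"
        using lin(1)[OF WM[OF w]] a x
        by (intro N.M.minus_equality[symmetric]) (simp_all add: N.M.a_comm)
      then have "inv\<^bsub>R\<^esub> a \<odot>\<^bsub>N\<^esub> (a \<odot>\<^bsub>N\<^esub> x) = inv\<^bsub>R\<^esub> a \<odot>\<^bsub>N\<^esub> \<ominus>\<^bsub>N\<^esub> f w"
        by simp
      then have "x = f (inv\<^bsub>R\<^esub> a \<odot>\<^bsub>M\<^esub> \<ominus>\<^bsub>M\<^esub> w)"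
        using a' a x WM[OF w] by (simp add: lin N.smult_assoc1[symmetric])
      then show ?thesis
        using none W_sub(4)[OF a'(1) W_sub(3)[OF w]] by metis
    qed
    ultimately have "L \<in> A"
      unfolding A_def L_def by blast
    moreover have "W \<subseteq> L"
    proof
      fix w assume "w \<in> W"
      then show "w \<in> L"
        unfolding L_def using e WM
        by (intro CollectI exI[of _ w] exI[of _ "\<zero>\<^bsub>R\<^esub>"]) simp
    qed
    ultimately have "L = W"
      by (rule max)
    moreover have "e \<in> L"
      unfolding L_def using W_sub(7) e
      by (intro CollectI exI[of _ "\<zero>\<^bsub>M\<^esub>"] exI[of _ "\<one>\<^bsub>R\<^esub>"]) simp
    ultimately show False
      using none e by metis
  qed
  have uniq: "w = w'" if "w \<in> W" "w' \<in> W" "f w = f w'" for w w'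
  proof -
    have "f (w \<oplus>\<^bsub>M\<^esub> \<ominus>\<^bsub>M\<^esub> w') = \<zero>\<^bsub>N\<^esub>"
      using that WM by (simp add: lin N.M.r_neg)
    then have "w \<oplus>\<^bsub>M\<^esub> \<ominus>\<^bsub>M\<^esub> w' = \<zero>\<^bsub>M\<^esub>"
      using ker[OF W_sub(5)[OF that(1) W_sub(3)[OF that(2)]]] by simp
    then show ?thesis
      using that WM M.M.minus_equality[of w "\<ominus>\<^bsub>M\<^esub> w'"] by simp
  qed
  define s where "s x = (SOME w. w \<in> W \<and> f w = x)" for x
  have s: "s x \<in> W" "f (s x) = x" if "x \<in> carrier N" for x
    using someI_ex[of "\<lambda>w. w \<in> W \<and> f w = x"] onto[OF that]
    by (auto simp: s_def Bex_def)
  have "linear_map R N M s"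
  proof (rule linear_mapI)
    show "s x \<in> carrier M" if "x \<in> carrier N" for x
      using WM[OF s(1)[OF that]] .
    show "s (x \<oplus>\<^bsub>N\<^esub> y) = s x \<oplus>\<^bsub>M\<^esub> s y" if "x \<in> carrier N" "y \<in> carrier N" for x y
      using that s WM W_sub by (intro uniq) (simp_all add: lin)
    show "s (a \<odot>\<^bsub>N\<^esub> x) = a \<odot>\<^bsub>M\<^esub> s x" if "a \<in> carrier R" "x \<in> carrier N" for a x
      using that s WM W_sub by (intro uniq) (simp_all add: lin)
  qed
  then show ?thesis
    using s(2) by metis
qed


section \<open>Cochains in low degree\<close>

lemma tuples_1: "tuples G 1 = {[x] | x. x \<in> carrier G}"
  by (auto simp: tuples_def length_Suc_conv)

lemma tuples_2: "tuples G 2 = {[x, y] | x y. x \<in> carrier G \<and> y \<in> carrier G}"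
  by (auto simp: tuples_def length_Suc_conv numeral_2_eq_2)

lemma tuples_3: "tuples G 3 = {[x, y, z] | x y z. x \<in> carrier G \<and> y \<in> carrier G \<and> z \<in> carrier G}"
  by (auto simp: tuples_def length_Suc_conv numeral_3_eq_3)

text \<open>The linearity condition of \<open>hom_space\<close> is quantified over tuples whose
  entry gets replaced, so some 1-tuple must exist for it to say anything. Alternation in zero
  arguments is vacuous.\<close>

lemma hom_space_1_iff:
  assumes "carrier G \<noteq> {}"
  shows "f \<in> hom_space R G V 1 \<longleftrightarrow>
    f \<in> extensional (tuples G 1) \<and> linear_map R G V (\<lambda>x. f [x])"
  using assms unfolding hom_space_def tuples_1 by auto

text \<open>Alternation concerns the first n - 1 arguments; for n = 2 that is a single argument, so
  bilinearity is all that remains.\<close>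

lemma hom_space_2_iff:
  "f \<in> hom_space R G V 2 \<longleftrightarrow>
    f \<in> extensional (tuples G 2) \<and>
    (\<forall>y\<in>carrier G. linear_map R G V (\<lambda>x. f [x, y])) \<and>
    (\<forall>x\<in>carrier G. linear_map R G V (\<lambda>y. f [x, y]))"
proof
  assume f: "f \<in> hom_space R G V 2"
  have upd: "linear_map R G V (\<lambda>x. f ([u, v][i := x]))"
    if "u \<in> carrier G" "v \<in> carrier G" "i < 2" for u v i
    using f that by (simp add: hom_space_def tuples_def del: list_update.simps(2))
  \<comment> \<open>The tuple \<open>[y, y]\<close> serves as seed: replacing its entry 0 or 1
    yields the two partial maps.\<close>
  have "linear_map R G V (\<lambda>x. f [x, y])" "linear_map R G V (\<lambda>x. f [y, x])" if "y \<in> carrier G" for y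
    using upd[of y y 0] upd[of y y 1] that by simp_all
  then show "f \<in> extensional (tuples G 2) \<and>
    (\<forall>y\<in>carrier G. linear_map R G V (\<lambda>x. f [x, y])) \<and>
    (\<forall>x\<in>carrier G. linear_map R G V (\<lambda>y. f [x, y]))"
    using f by (simp add: hom_space_def)
next
  assume "f \<in> extensional (tuples G 2) \<and>
    (\<forall>y\<in>carrier G. linear_map R G V (\<lambda>x. f [x, y])) \<and>
    (\<forall>x\<in>carrier G. linear_map R G V (\<lambda>y. f [x, y]))"
  then show "f \<in> hom_space R G V 2"
    unfolding hom_space_def tuples_2 by (auto simp: numeral_2_eq_2 less_Suc_eq)
qed

context pre_lie_algebra begin

lemma G_module: "module R G" ..

lemma product_closed [simp]:
  "\<lbrakk>x \<in> carrier G; y \<in> carrier G\<rbrakk> \<Longrightarrow> x \<otimes>\<^bsub>G\<^esub> y \<in> carrier G"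
  using linear_map_closed[OF product_linear_left] by blast

lemma commutator_closed [simp]:
  "\<lbrakk>x \<in> carrier G; y \<in> carrier G\<rbrakk> \<Longrightarrow> commutator G x y \<in> carrier G"
  by (simp add: commutator_def)

lemma product_add_left:
  "\<lbrakk>x \<in> carrier G; y \<in> carrier G; z \<in> carrier G\<rbrakk> \<Longrightarrow>
    (x \<oplus>\<^bsub>G\<^esub> y) \<otimes>\<^bsub>G\<^esub> z = x \<otimes>\<^bsub>G\<^esub> z \<oplus>\<^bsub>G\<^esub> y \<otimes>\<^bsub>G\<^esub> z"
  using linear_map_add[OF product_linear_left] by blast

lemma product_add_right:
  "\<lbrakk>x \<in> carrier G; y \<in> carrier G; z \<in> carrier G\<rbrakk> \<Longrightarrow>
    x \<otimes>\<^bsub>G\<^esub> (y \<oplus>\<^bsub>G\<^esub> z) = x \<otimes>\<^bsub>G\<^esub> y \<oplus>\<^bsub>G\<^esub> x \<otimes>\<^bsub>G\<^esub> z"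
  using linear_map_add[OF product_linear_right] by blast

lemma product_smult_left:
  "\<lbrakk>a \<in> carrier R; x \<in> carrier G; y \<in> carrier G\<rbrakk> \<Longrightarrow>
    (a \<odot>\<^bsub>G\<^esub> x) \<otimes>\<^bsub>G\<^esub> y = a \<odot>\<^bsub>G\<^esub> (x \<otimes>\<^bsub>G\<^esub> y)"
  using linear_map_smult[OF product_linear_left] by blast

lemma product_smult_right:
  "\<lbrakk>a \<in> carrier R; x \<in> carrier G; y \<in> carrier G\<rbrakk> \<Longrightarrow>
    x \<otimes>\<^bsub>G\<^esub> (a \<odot>\<^bsub>G\<^esub> y) = a \<odot>\<^bsub>G\<^esub> (x \<otimes>\<^bsub>G\<^esub> y)"
  using linear_map_smult[OF product_linear_right] by blast

lemmas product_bilinear =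
  product_add_left product_add_right product_smult_left product_smult_right

end

context preLie_representation begin

lemma V_module: "module R V" ..

lemma action_closed [simp]:
  "\<lbrakk>x \<in> carrier G; u \<in> carrier V\<rbrakk> \<Longrightarrow> \<rho> x u \<in> carrier V"
  "\<lbrakk>x \<in> carrier G; u \<in> carrier V\<rbrakk> \<Longrightarrow> \<mu> x u \<in> carrier V"
  using linear_map_closed[OF \<rho>_endo] linear_map_closed[OF \<mu>_endo] by blast+

lemmas action_bilinear =
  linear_map_add[OF \<rho>_endo] linear_map_add[OF \<mu>_endo]
  linear_map_smult[OF \<rho>_endo] linear_map_smult[OF \<mu>_endo]
  linear_map_add[OF \<rho>_linear] linear_map_add[OF \<mu>_linear]
  linear_map_smult[OF \<rho>_linear] linear_map_smult[OF \<mu>_linear]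

lemmas action_minus =
  linear_map_minus[OF \<rho>_endo V_module V_module] linear_map_minus[OF \<mu>_endo V_module V_module]
  linear_map_minus[OF \<rho>_linear G_module V_module] linear_map_minus[OF \<mu>_linear G_module V_module]

lemma sgn_smult_eval:
  assumes "v \<in> carrier V"
  shows "sgn_smult R V 0 v = v" "sgn_smult R V (Suc 0) v = \<ominus>\<^bsub>V\<^esub> v" "sgn_smult R V 2 v = v"
  using assms by (simp_all add: sgn_smult_def V.smult_l_minus numeral_2_eq_2 l_minus)

lemma hom_space_1D:
  assumes "f \<in> hom_space R G V 1"
  shows "f \<in> extensional (tuples G 1)" "linear_map R G V (\<lambda>x. f [x])"
    "x \<in> carrier G \<Longrightarrow> f [x] \<in> carrier V"
  using assms linear_map_closed[of R G V "\<lambda>x. f [x]"] hom_space_1_iff[of G f R V] by auto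

lemma hom_space_2D:
  assumes "f \<in> hom_space R G V 2"
  shows "f \<in> extensional (tuples G 2)"
    "y \<in> carrier G \<Longrightarrow> linear_map R G V (\<lambda>x. f [x, y])"
    "x \<in> carrier G \<Longrightarrow> linear_map R G V (\<lambda>y. f [x, y])"
    "x \<in> carrier G \<Longrightarrow> y \<in> carrier G \<Longrightarrow> f [x, y] \<in> carrier V"
  using assms linear_map_closed[of R G V "\<lambda>x. f [x, y]"] by (auto simp: hom_space_2_iff)

text \<open>All sums in \<open>d\<close> are empty for n = 0. The case occurs because
  \<open>coboundary\<close> in degree 1 applies \<open>d\<close> to a component of degree 0.\<close>

lemma d_0:
  assumes "x \<in> carrier G"
  shows "d R G V \<rho> \<mu> 0 f [x] = \<zero>\<^bsub>V\<^esub>"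
  using assms by (simp add: d_def tuples_def a_minus_def)

lemma d_1:
  assumes "f \<in> hom_space R G V 1" "x \<in> carrier G" "y \<in> carrier G"
  shows "d R G V \<rho> \<mu> 1 f [x, y] = \<rho> x (f [y]) \<oplus>\<^bsub>V\<^esub> \<mu> y (f [x]) \<ominus>\<^bsub>V\<^esub> f [x \<otimes>\<^bsub>G\<^esub> y]"
proof -
  have no_pairs: "{(i, j). i < j \<and> j < (1::nat)} = {}"
    by auto
  have lt: "{..<1::nat} = {0}"
    by auto
  have "[x, y] \<in> tuples G (1 + 1)"
    using assms by (simp add: tuples_def)
  then show ?thesis
    using assms(2,3) hom_space_1D(3)[OF assms(1)]
    unfolding d_def no_pairs lt by (simp add: sgn_smult_eval nths_Cons)
qed

text \<open>The terms stay in the order and with the signs that \<open>d\<close> produces, so that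
  \<open>associator_arith\<close> applies verbatim. Only the commutator term is reworked, by
  linearity of \<open>f\<close> in its first argument.\<close>

lemma d_2:
  assumes "f \<in> hom_space R G V 2" "x \<in> carrier G" "y \<in> carrier G" "z \<in> carrier G"
  shows "d R G V \<rho> \<mu> 2 f [x, y, z] =
    (\<rho> x (f [y, z]) \<oplus>\<^bsub>V\<^esub> \<ominus>\<^bsub>V\<^esub> \<rho> y (f [x, z])) \<oplus>\<^bsub>V\<^esub>
    (\<mu> z (f [y, x]) \<oplus>\<^bsub>V\<^esub> \<ominus>\<^bsub>V\<^esub> \<mu> z (f [x, y])) \<ominus>\<^bsub>V\<^esub>
    (f [y, x \<otimes>\<^bsub>G\<^esub> z] \<oplus>\<^bsub>V\<^esub> \<ominus>\<^bsub>V\<^esub> f [x, y \<otimes>\<^bsub>G\<^esub> z]) \<oplus>\<^bsub>V\<^esub>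
    \<ominus>\<^bsub>V\<^esub> (f [x \<otimes>\<^bsub>G\<^esub> y, z] \<ominus>\<^bsub>V\<^esub> f [y \<otimes>\<^bsub>G\<^esub> x, z])"
proof -
  note f = hom_space_2D(4)[OF assms(1)]
  have pairs: "{(i, j). i < j \<and> j < (2::nat)} = {(0, 1)}"
    by auto
  have lt: "{..<2::nat} = {0, 1}"
    by auto
  have "[x, y, z] \<in> tuples G (2 + 1)"
    using assms by (simp add: tuples_def)
  moreover have "f [commutator G x y, z] = f [x \<otimes>\<^bsub>G\<^esub> y, z] \<ominus>\<^bsub>V\<^esub> f [y \<otimes>\<^bsub>G\<^esub> x, z]"
    using assms linear_map_minus[OF hom_space_2D(2)[OF assms(1)] G_module V_module]
    by (simp add: commutator_def)
  ultimately show ?thesis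
    using assms(2-4) f
    by (simp add: d_def pairs lt sgn_smult_eval nths_Cons)
qed

end

context preLieDer_representation begin

lemma der_closed [simp]:
  "x \<in> carrier G \<Longrightarrow> D x \<in> carrier G" "u \<in> carrier V \<Longrightarrow> K u \<in> carrier V"
  using linear_map_closed[OF D_linear] linear_map_closed[OF K_linear] by blast+

lemmas der_linear =
  linear_map_add[OF D_linear] linear_map_smult[OF D_linear]
  linear_map_add[OF K_linear] linear_map_smult[OF K_linear]

text \<open>The sign is -1 in degree 1, which reverses the difference. The result is the amount by
  which the derivation part of a cochain changes when \<phi> is added to a section.\<close>

lemma Omega_1:
  assumes "f \<in> hom_space R G V 1" "x \<in> carrier G"
  shows "Omega R G D V K 1 f [x] = K (f [x]) \<ominus>\<^bsub>V\<^esub> f [D x]"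
proof -
  note f = hom_space_1D(3)[OF assms(1)]
  have "[x] \<in> tuples G 1"
    using assms tuples_1 by blast
  then have "Omega R G D V K 1 f [x] = \<ominus>\<^bsub>V\<^esub> (f [D x] \<ominus>\<^bsub>V\<^esub> K (f [x]))"
    using assms(2) f by (simp add: Omega_def sgn_smult_eval lessThan_Suc)
  then show ?thesis
    using assms(2) f by (simp add: a_minus_def V.M.minus_add V.M.a_comm)
qed

lemma Omega_2:
  assumes "f \<in> hom_space R G V 2" "x \<in> carrier G" "y \<in> carrier G"
  shows "Omega R G D V K 2 f [x, y] = f [D x, y] \<oplus>\<^bsub>V\<^esub> f [x, D y] \<ominus>\<^bsub>V\<^esub> K (f [x, y])"
proof -
  note f = hom_space_2D(4)[OF assms(1)]
  have lt: "{..<2::nat} = {0, 1}"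
    by auto
  have "[x, y] \<in> tuples G 2"
    using assms tuples_2 by blast
  then show ?thesis
    using assms(2,3) f by (simp add: Omega_def sgn_smult_eval lt)
qed

text \<open>The two equations are arranged as the V-components of left symmetry and of the Leibniz
  rule in the twisted product, taken at pairs with zero second entry. All later use of cocycles goes
  through this form.\<close>

lemma cocycles_2_iff:
  "(f, \<theta>) \<in> cocycles R G D V K \<rho> \<mu> 2 \<longleftrightarrow>
    f \<in> hom_space R G V 2 \<and> \<theta> \<in> hom_space R G V 1 \<and>
    (\<forall>x\<in>carrier G. \<forall>y\<in>carrier G. \<forall>z\<in>carrier G.
      (f [x \<otimes>\<^bsub>G\<^esub> y, z] \<oplus>\<^bsub>V\<^esub> \<mu> z (f [x, y])) \<ominus>\<^bsub>V\<^esub> (f [x, y \<otimes>\<^bsub>G\<^esub> z] \<oplus>\<^bsub>V\<^esub> \<rho> x (f [y, z])) =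
      (f [y \<otimes>\<^bsub>G\<^esub> x, z] \<oplus>\<^bsub>V\<^esub> \<mu> z (f [y, x])) \<ominus>\<^bsub>V\<^esub> (f [y, x \<otimes>\<^bsub>G\<^esub> z] \<oplus>\<^bsub>V\<^esub> \<rho> y (f [x, z]))) \<and>
    (\<forall>x\<in>carrier G. \<forall>y\<in>carrier G.
      \<rho> x (\<theta> [y]) \<oplus>\<^bsub>V\<^esub> \<mu> y (\<theta> [x]) \<oplus>\<^bsub>V\<^esub> (f [D x, y] \<oplus>\<^bsub>V\<^esub> f [x, D y]) =
      \<theta> [x \<otimes>\<^bsub>G\<^esub> y] \<oplus>\<^bsub>V\<^esub> K (f [x, y]))"
  (is "_ \<longleftrightarrow> _ \<and> _ \<and> ?A \<and> ?B")
proof (cases "f \<in> hom_space R G V 2 \<and> \<theta> \<in> hom_space R G V 1")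
  case True
  then have f: "f \<in> hom_space R G V 2" and \<theta>: "\<theta> \<in> hom_space R G V 1"
    by auto
  note val = hom_space_2D(4)[OF f] hom_space_1D(3)[OF \<theta>]
  have "(f, \<theta>) \<in> cocycles R G D V K \<rho> \<mu> 2 \<longleftrightarrow>
    d R G V \<rho> \<mu> 2 f = (\<lambda>xs\<in>tuples G 3. \<zero>\<^bsub>V\<^esub>) \<and>
    (\<lambda>xs\<in>tuples G 2. d R G V \<rho> \<mu> 1 \<theta> xs \<oplus>\<^bsub>V\<^esub> Omega R G D V K 2 f xs) = (\<lambda>xs\<in>tuples G 2. \<zero>\<^bsub>V\<^esub>)"
    using True by (simp add: cocycles_def kernel_def cochains_def coboundary_def hom_group_def)
  also have "d R G V \<rho> \<mu> 2 f = (\<lambda>xs\<in>tuples G 3. \<zero>\<^bsub>V\<^esub>) \<longleftrightarrow>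
      (\<forall>xs\<in>tuples G 3. d R G V \<rho> \<mu> 2 f xs = \<zero>\<^bsub>V\<^esub>)"
    by (auto simp: fun_eq_iff d_def)
  also have "\<dots> \<longleftrightarrow> (\<forall>x\<in>carrier G. \<forall>y\<in>carrier G. \<forall>z\<in>carrier G. d R G V \<rho> \<mu> 2 f [x, y, z] = \<zero>\<^bsub>V\<^esub>)"
    unfolding tuples_3 by blast
  also have "\<dots> \<longleftrightarrow> ?A"
    by (intro ball_cong refl, subst d_2[OF f], assumption+, rule V.M.associator_arith)
      (simp_all add: val)
  also have "(\<lambda>xs\<in>tuples G 2. d R G V \<rho> \<mu> 1 \<theta> xs \<oplus>\<^bsub>V\<^esub> Omega R G D V K 2 f xs) = (\<lambda>xs\<in>tuples G 2. \<zero>\<^bsub>V\<^esub>) \<longleftrightarrow>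
      (\<forall>xs\<in>tuples G 2. d R G V \<rho> \<mu> 1 \<theta> xs \<oplus>\<^bsub>V\<^esub> Omega R G D V K 2 f xs = \<zero>\<^bsub>V\<^esub>)"
    by (auto simp: fun_eq_iff)
  also have "\<dots> \<longleftrightarrow> (\<forall>x\<in>carrier G. \<forall>y\<in>carrier G.
      d R G V \<rho> \<mu> 1 \<theta> [x, y] \<oplus>\<^bsub>V\<^esub> Omega R G D V K 2 f [x, y] = \<zero>\<^bsub>V\<^esub>)"
    unfolding tuples_2 by blast
  also have "\<dots> \<longleftrightarrow> ?B"
    by (intro ball_cong refl, subst d_1[OF \<theta>], assumption+, subst Omega_2[OF f], assumption+,
        rule V.M.derivation_arith)
      (simp_all add: val)
  finally show ?thesis
    using True by blast
next
  case False
  then show ?thesis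
    by (auto simp: cocycles_def kernel_def cochains_def hom_group_def)
qed

end


section \<open>The group of cohomology classes\<close>

lemma tuples_update:
  "xs \<in> tuples G n \<Longrightarrow> x \<in> carrier G \<Longrightarrow> xs[i := x] \<in> tuples G n"
  using set_update_subset_insert[of xs i x] by (auto simp: tuples_def)

lemma restrict_eqI:
  assumes "f \<in> extensional A" "\<And>x. x \<in> A \<Longrightarrow> f x = g x"
  shows "f = (\<lambda>x\<in>A. g x)"
  using assms by (auto simp: fun_eq_iff extensional_def)

section \<open>Pointwise addition on cochains of any degree\<close>

context preLie_representation begin

lemma hom_space_extensional: "f \<in> hom_space R G V n \<Longrightarrow> f \<in> extensional (tuples G n)"
  by (auto simp: hom_space_def split: if_splits)

text \<open>A tuple is its own update at position 0, so the value is one of a linear map into V.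
  Degree 0 has no position and falls under the convention that its space is zero.\<close>

lemma hom_space_closed:
  assumes "f \<in> hom_space R G V n" "xs \<in> tuples G n"
  shows "f xs \<in> carrier V"
proof (cases "n = 0")
  case True
  then show ?thesis
    using assms by (simp add: hom_space_def)
next
  case False
  then have "xs ! 0 \<in> carrier G"
    using assms(2) by (auto simp: tuples_def)
  moreover have "linear_map R G V (\<lambda>x. f (xs[0 := x]))"
    using False assms by (simp add: hom_space_def)
  ultimately show ?thesis
    using linear_map_closed[of R G V "\<lambda>x. f (xs[0 := x])" "xs ! 0"] by simp
qed

lemma hom_space_linear:
  assumes "f \<in> hom_space R G V n" "xs \<in> tuples G n" "i < n"
  shows "linear_map R G V (\<lambda>x. f (xs[i := x]))"
  using assms by (simp add: hom_space_def split: if_splits)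

lemma hom_space_alternating:
  assumes "f \<in> hom_space R G V n" "xs \<in> tuples G n" "i < j" "j < n - 1" "xs ! i = xs ! j"
  shows "f xs = \<zero>\<^bsub>V\<^esub>"
proof -
  have "n \<noteq> 0"
    using assms by auto
  then have "\<forall>xs \<in> tuples G n. \<forall>i j. i < j \<and> j < n - 1 \<and> xs ! i = xs ! j \<longrightarrow> f xs = \<zero>\<^bsub>V\<^esub>"
    using assms(1) unfolding hom_space_def by simp
  then show ?thesis
    using assms by metis
qed

lemma hom_space_add:
  assumes f: "f \<in> hom_space R G V n" and g: "g \<in> hom_space R G V n"
  shows "(\<lambda>xs\<in>tuples G n. f xs \<oplus>\<^bsub>V\<^esub> g xs) \<in> hom_space R G V n"
proof (cases "n = 0")
  case True
  then have "(\<lambda>xs\<in>tuples G n. f xs \<oplus>\<^bsub>V\<^esub> g xs) = (\<lambda>xs\<in>tuples G n. \<zero>\<^bsub>V\<^esub>)"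
    using f g by (auto simp: hom_space_def)
  then show ?thesis
    using True by (simp add: hom_space_def)
next
  case False
  have "linear_map R G V (\<lambda>x. (\<lambda>xs\<in>tuples G n. f xs \<oplus>\<^bsub>V\<^esub> g xs) (xs[i := x]))"
    if xs: "xs \<in> tuples G n" and i: "i < n" for xs i
  proof (rule linear_mapI)
    note lin = hom_space_linear[OF f xs i] hom_space_linear[OF g xs i]
    note val = hom_space_closed[OF f] hom_space_closed[OF g] tuples_update[OF xs]
    show "(\<lambda>xs\<in>tuples G n. f xs \<oplus>\<^bsub>V\<^esub> g xs) (xs[i := x]) \<in> carrier V" if "x \<in> carrier G" for x
      using that by (simp add: val)
    show "(\<lambda>xs\<in>tuples G n. f xs \<oplus>\<^bsub>V\<^esub> g xs) (xs[i := x \<oplus>\<^bsub>G\<^esub> y]) =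
        (\<lambda>xs\<in>tuples G n. f xs \<oplus>\<^bsub>V\<^esub> g xs) (xs[i := x]) \<oplus>\<^bsub>V\<^esub>
        (\<lambda>xs\<in>tuples G n. f xs \<oplus>\<^bsub>V\<^esub> g xs) (xs[i := y])"
      if "x \<in> carrier G" "y \<in> carrier G" for x y
      using that linear_map_add[OF lin(1)] linear_map_add[OF lin(2)] by (simp add: val V.M.a_ac)
    show "(\<lambda>xs\<in>tuples G n. f xs \<oplus>\<^bsub>V\<^esub> g xs) (xs[i := a \<odot>\<^bsub>G\<^esub> x]) =
        a \<odot>\<^bsub>V\<^esub> (\<lambda>xs\<in>tuples G n. f xs \<oplus>\<^bsub>V\<^esub> g xs) (xs[i := x])"
      if "a \<in> carrier R" "x \<in> carrier G" for a x
      using that linear_map_smult[OF lin(1)] linear_map_smult[OF lin(2)]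
      by (simp add: val V.smult_r_distr)
  qed
  moreover have "f xs \<oplus>\<^bsub>V\<^esub> g xs = \<zero>\<^bsub>V\<^esub>"
    if "xs \<in> tuples G n" "i < j" "j < n - 1" "xs ! i = xs ! j" for xs i j
    using hom_space_alternating[OF f that] hom_space_alternating[OF g that] by simp
  ultimately show ?thesis
    using False unfolding hom_space_def by auto
qed

lemma hom_space_zero: "(\<lambda>xs\<in>tuples G n. \<zero>\<^bsub>V\<^esub>) \<in> hom_space R G V n"
  by (auto simp: hom_space_def linear_map_def tuples_update)

lemma hom_space_neg:
  assumes f: "f \<in> hom_space R G V n"
  shows "(\<lambda>xs\<in>tuples G n. \<ominus>\<^bsub>V\<^esub> f xs) \<in> hom_space R G V n"
proof (cases "n = 0")
  case True
  then have "(\<lambda>xs\<in>tuples G n. \<ominus>\<^bsub>V\<^esub> f xs) = (\<lambda>xs\<in>tuples G n. \<zero>\<^bsub>V\<^esub>)"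
    using f by (auto simp: hom_space_def)
  then show ?thesis
    using True by (simp add: hom_space_def)
next
  case False
  have "linear_map R G V (\<lambda>x. (\<lambda>xs\<in>tuples G n. \<ominus>\<^bsub>V\<^esub> f xs) (xs[i := x]))"
    if xs: "xs \<in> tuples G n" and i: "i < n" for xs i
  proof (rule linear_mapI)
    note lin = hom_space_linear[OF f xs i]
    note val = hom_space_closed[OF f] tuples_update[OF xs]
    show "(\<lambda>xs\<in>tuples G n. \<ominus>\<^bsub>V\<^esub> f xs) (xs[i := x]) \<in> carrier V" if "x \<in> carrier G" for x
      using that by (simp add: val)
    show "(\<lambda>xs\<in>tuples G n. \<ominus>\<^bsub>V\<^esub> f xs) (xs[i := x \<oplus>\<^bsub>G\<^esub> y]) =
        (\<lambda>xs\<in>tuples G n. \<ominus>\<^bsub>V\<^esub> f xs) (xs[i := x]) \<oplus>\<^bsub>V\<^esub>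
        (\<lambda>xs\<in>tuples G n. \<ominus>\<^bsub>V\<^esub> f xs) (xs[i := y])"
      if "x \<in> carrier G" "y \<in> carrier G" for x y
      using that linear_map_add[OF lin] by (simp add: val V.M.minus_add)
    show "(\<lambda>xs\<in>tuples G n. \<ominus>\<^bsub>V\<^esub> f xs) (xs[i := a \<odot>\<^bsub>G\<^esub> x]) =
        a \<odot>\<^bsub>V\<^esub> (\<lambda>xs\<in>tuples G n. \<ominus>\<^bsub>V\<^esub> f xs) (xs[i := x])"
      if "a \<in> carrier R" "x \<in> carrier G" for a x
      using that linear_map_smult[OF lin] by (simp add: val V.smult_r_minus)
  qed
  moreover have "\<ominus>\<^bsub>V\<^esub> f xs = \<zero>\<^bsub>V\<^esub>"
    if "xs \<in> tuples G n" "i < j" "j < n - 1" "xs ! i = xs ! j" for xs i j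
    using hom_space_alternating[OF f that] by simp
  ultimately show ?thesis
    using False unfolding hom_space_def by auto
qed

lemma hom_group_group: "group (hom_group R G V n)"
proof (rule groupI)
  fix f g h
  assume f: "f \<in> carrier (hom_group R G V n)"
  then have f': "f \<in> hom_space R G V n"
    by (simp add: hom_group_def)
  note val = hom_space_closed[OF f']
  show "\<one>\<^bsub>hom_group R G V n\<^esub> \<otimes>\<^bsub>hom_group R G V n\<^esub> f = f"
    by (simp add: hom_group_def restrict_eqI[OF hom_space_extensional[OF f'], symmetric] val)
  have "(\<lambda>xs\<in>tuples G n. \<ominus>\<^bsub>V\<^esub> f xs) \<otimes>\<^bsub>hom_group R G V n\<^esub> f = \<one>\<^bsub>hom_group R G V n\<^esub>"
    by (auto simp: hom_group_def fun_eq_iff val V.M.l_neg)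
  then show "\<exists>g\<in>carrier (hom_group R G V n). g \<otimes>\<^bsub>hom_group R G V n\<^esub> f = \<one>\<^bsub>hom_group R G V n\<^esub>"
    using hom_space_neg[OF f'] by (intro bexI) (simp_all add: hom_group_def)
  assume g: "g \<in> carrier (hom_group R G V n)"
  then have g': "g \<in> hom_space R G V n"
    by (simp add: hom_group_def)
  show "f \<otimes>\<^bsub>hom_group R G V n\<^esub> g \<in> carrier (hom_group R G V n)"
    using hom_space_add[OF f' g'] by (simp add: hom_group_def)
  assume h: "h \<in> carrier (hom_group R G V n)"
  then have h': "h \<in> hom_space R G V n"
    by (simp add: hom_group_def)
  show "f \<otimes>\<^bsub>hom_group R G V n\<^esub> g \<otimes>\<^bsub>hom_group R G V n\<^esub> h =
    f \<otimes>\<^bsub>hom_group R G V n\<^esub> (g \<otimes>\<^bsub>hom_group R G V n\<^esub> h)"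
    by (auto simp: hom_group_def fun_eq_iff val hom_space_closed[OF g'] hom_space_closed[OF h']
        V.M.a_assoc)
next
  show "\<one>\<^bsub>hom_group R G V n\<^esub> \<in> carrier (hom_group R G V n)"
    using hom_space_zero by (simp add: hom_group_def)
qed

lemma cochains_group: "group (cochains R G V n)"
  unfolding cochains_def by (intro DirProd_group hom_group_group)

end

section \<open>Degree-two coboundaries and equality of classes\<close>

context preLieDer_representation begin

text \<open>The degree-0 cochains form the zero space, so a cochain of degree 1 amounts to one map
  \<phi>, and its coboundary can be written as a function of \<phi> alone.\<close>

definition coboundary1 where
  "coboundary1 \<phi> =
    (\<lambda>xs\<in>tuples G 2. \<rho> (xs ! 0) (\<phi> [xs ! 1]) \<oplus>\<^bsub>V\<^esub> \<mu> (xs ! 1) (\<phi> [xs ! 0]) \<ominus>\<^bsub>V\<^esub>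
        \<phi> [xs ! 0 \<otimes>\<^bsub>G\<^esub> xs ! 1],
     \<lambda>xs\<in>tuples G 1. K (\<phi> xs) \<ominus>\<^bsub>V\<^esub> \<phi> [D (xs ! 0)])"

lemma coboundary1_apply:
  "x \<in> carrier G \<Longrightarrow> y \<in> carrier G \<Longrightarrow> fst (coboundary1 \<phi>) [x, y] =
    \<rho> x (\<phi> [y]) \<oplus>\<^bsub>V\<^esub> \<mu> y (\<phi> [x]) \<ominus>\<^bsub>V\<^esub> \<phi> [x \<otimes>\<^bsub>G\<^esub> y]"
  "x \<in> carrier G \<Longrightarrow> snd (coboundary1 \<phi>) [x] = K (\<phi> [x]) \<ominus>\<^bsub>V\<^esub> \<phi> [D x]"
  by (simp_all add: coboundary1_def tuples_def)

lemma coboundary_1: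
  assumes "\<phi> \<in> hom_space R G V 1"
  shows "coboundary R G D V K \<rho> \<mu> 1 (\<phi>, \<theta>) = coboundary1 \<phi>"
proof -
  note val = hom_space_1D(3)[OF assms]
  have "d R G V \<rho> \<mu> 1 \<phi> = fst (coboundary1 \<phi>)"
    unfolding coboundary1_def fst_conv
  proof (rule restrict_eqI)
    show "d R G V \<rho> \<mu> 1 \<phi> \<in> extensional (tuples G 2)"
      by (simp add: d_def numeral_2_eq_2)
  qed (use d_1[OF assms] in \<open>auto simp: tuples_2\<close>)
  moreover have "(\<lambda>xs\<in>tuples G 1. d R G V \<rho> \<mu> 0 \<theta> xs \<oplus>\<^bsub>V\<^esub> Omega R G D V K 1 \<phi> xs) =
      snd (coboundary1 \<phi>)"
    unfolding coboundary1_def snd_conv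
    by (rule restrict_ext) (auto simp: tuples_1[unfolded One_nat_def] d_0 Omega_1[OF assms, unfolded One_nat_def] val)
  ultimately show ?thesis
    by (simp add: coboundary_def)
qed

lemma coboundaries_2: "coboundaries R G D V K \<rho> \<mu> 2 = coboundary1 ` hom_space R G V 1"
proof -
  have "coboundaries R G D V K \<rho> \<mu> 2 =
    coboundary R G D V K \<rho> \<mu> 1 ` (hom_space R G V 1 \<times> hom_space R G V 0)"
    by (simp add: coboundaries_def cochains_def hom_group_def)
  also have "\<dots> = coboundary1 ` hom_space R G V 1"
    using hom_space_zero[of 0] coboundary_1 by (force simp: image_iff)
  finally show ?thesis .
qed

lemma coboundary1_closed:
  assumes "\<phi> \<in> hom_space R G V 1"
  shows "coboundary1 \<phi> \<in> carrier (cochains R G V 2)"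
proof -
  note val = hom_space_1D(3)[OF assms]
  note lin = linear_map_add[OF hom_space_1D(2)[OF assms]] linear_map_smult[OF hom_space_1D(2)[OF assms]]
    action_bilinear product_bilinear der_linear
  note arith = a_minus_def V.M.minus_add V.M.a_ac V.smult_r_distr V.smult_r_minus
  have "fst (coboundary1 \<phi>) \<in> hom_space R G V 2"
    unfolding hom_space_2_iff
  proof (intro conjI ballI linear_mapI)
    show "fst (coboundary1 \<phi>) \<in> extensional (tuples G 2)"
      by (simp add: coboundary1_def)
  qed (simp_all add: coboundary1_apply val lin, simp_all add: arith val)
  moreover have "snd (coboundary1 \<phi>) \<in> hom_space R G V 1"
  proof -
    have "linear_map R G V (\<lambda>x. snd (coboundary1 \<phi>) [x])"
      by (rule linear_mapI) (simp_all add: coboundary1_apply val lin, simp_all add: arith val)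
    moreover have "snd (coboundary1 \<phi>) \<in> extensional (tuples G 1)"
      by (simp add: coboundary1_def)
    ultimately show ?thesis
      using hom_space_1_iff[of G "snd (coboundary1 \<phi>)" R V] by auto
  qed
  ultimately show ?thesis
    by (cases "coboundary1 \<phi>") (simp add: cochains_def hom_group_def)
qed

text \<open>Image of the group homomorphism \<open>coboundary1\<close>. Being a subgroup makes the
  cosets partition the cochains, which is what turns equality of classes into a difference by a
  coboundary.\<close>

lemma coboundaries_2_subgroup: "subgroup (coboundaries R G D V K \<rho> \<mu> 2) (cochains R G V 2)"
proof -
  have "coboundary1 \<in> hom (hom_group R G V 1) (cochains R G V 2)"
  proof (rule homI)
    fix f g assume "f \<in> carrier (hom_group R G V 1)" "g \<in> carrier (hom_group R G V 1)"
    then have f: "f \<in> hom_space R G V 1" and g: "g \<in> hom_space R G V 1"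
      by (auto simp: hom_group_def)
    note val = hom_space_1D(3)[OF f] hom_space_1D(3)[OF g]
    note arith = a_minus_def V.M.minus_add V.M.a_ac
    have ap: "(\<lambda>xs\<in>tuples G 1. f xs \<oplus>\<^bsub>V\<^esub> g xs) [x] = f [x] \<oplus>\<^bsub>V\<^esub> g [x]" if "x \<in> carrier G" for x
      using that by (simp add: tuples_def)
    show "coboundary1 (f \<otimes>\<^bsub>hom_group R G V 1\<^esub> g) =
      coboundary1 f \<otimes>\<^bsub>cochains R G V 2\<^esub> coboundary1 g"
      unfolding coboundary1_def cochains_def hom_group_def
      by (auto simp: fun_eq_iff tuples_1[unfolded One_nat_def] tuples_2 ap[unfolded One_nat_def] val action_bilinear der_linear)
        (simp_all add: arith val)
  qed (simp add: coboundary1_closed hom_group_def)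
  then have "group_hom (hom_group R G V 1) (cochains R G V 2) coboundary1"
    by (intro group_hom.intro group_hom_axioms.intro hom_group_group cochains_group)
  from group_hom.img_is_subgroup[OF this] show ?thesis
    by (simp add: coboundaries_2 hom_group_def)
qed

text \<open>The coboundary stands on the left because the cosets are right cosets. This is the shape
  in which \<open>change_section\<close> delivers the effect of a new section.\<close>

lemma cohomology_class_eq_iff:
  assumes "c \<in> carrier (cochains R G V 2)" "c' \<in> carrier (cochains R G V 2)"
  shows "cohomology_class R G D V K \<rho> \<mu> 2 c = cohomology_class R G D V K \<rho> \<mu> 2 c' \<longleftrightarrow>
    (\<exists>\<phi>\<in>hom_space R G V 1. c = coboundary1 \<phi> \<otimes>\<^bsub>cochains R G V 2\<^esub> c')"
proof -
  interpret C: group "cochains R G V 2"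
    by (rule cochains_group)
  let ?B = "coboundaries R G D V K \<rho> \<mu> 2"
  \<comment> \<open>A coset depends only on the multiplication, and \<open>cocycle_group\<close>
    shares it with \<open>cochains\<close>; so cosets can be compared in the full cochain
    group.\<close>
  have "cohomology_class R G D V K \<rho> \<mu> 2 a = ?B #>\<^bsub>cochains R G V 2\<^esub> a" for a
    by (simp add: cohomology_class_def cocycle_group_def r_coset_def)
  moreover have "?B #>\<^bsub>cochains R G V 2\<^esub> c = ?B #>\<^bsub>cochains R G V 2\<^esub> c' \<longleftrightarrow>
      c \<in> ?B #>\<^bsub>cochains R G V 2\<^esub> c'"
    using C.repr_independence[OF _ assms(2) coboundaries_2_subgroup]
      C.rcos_self[OF assms(1) coboundaries_2_subgroup] by metis
  ultimately show ?thesis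
    by (auto simp: r_coset_def coboundaries_2)
qed

lemma carrier_cohomology:
  "carrier (cohomology R G D V K \<rho> \<mu> n) =
    cohomology_class R G D V K \<rho> \<mu> n ` cocycles R G D V K \<rho> \<mu> n"
  by (auto simp: cohomology_def FactGroup_def RCOSETS_def cohomology_class_def cocycle_group_def)

end


section \<open>The twisted product\<close>

lemma preLieDer_homD:
  assumes "preLieDer_hom R G D H E f"
  shows "x \<in> carrier G \<Longrightarrow> f x \<in> carrier H"
    "x \<in> carrier G \<Longrightarrow> y \<in> carrier G \<Longrightarrow> f (x \<oplus>\<^bsub>G\<^esub> y) = f x \<oplus>\<^bsub>H\<^esub> f y"
    "a \<in> carrier R \<Longrightarrow> x \<in> carrier G \<Longrightarrow> f (a \<odot>\<^bsub>G\<^esub> x) = a \<odot>\<^bsub>H\<^esub> f x"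
    "x \<in> carrier G \<Longrightarrow> y \<in> carrier G \<Longrightarrow> f (x \<otimes>\<^bsub>G\<^esub> y) = f x \<otimes>\<^bsub>H\<^esub> f y"
    "x \<in> carrier G \<Longrightarrow> f (D x) = E (f x)"
  using assms by (auto simp: preLieDer_hom_def linear_map_def)

text \<open>Every axiom is an equation: it holds in \<open>N\<close> after applying
  \<open>h\<close>, and injectivity takes it back to \<open>M\<close>. Only closure of the
  operations has to be supplied. It is applied to \<open>assemble\<close>, with an extension as
  target, and to the inverse of an embedding into the universe, with a twisted product as
  target.\<close>

lemma pullback_regular_preLieDer:
  assumes N: "regular_preLieDer R N E"
    and hom: "preLieDer_hom R M D N E h" and inj: "inj_on h (carrier M)"
    and zero: "\<zero>\<^bsub>M\<^esub> \<in> carrier M" "h \<zero>\<^bsub>M\<^esub> = \<zero>\<^bsub>N\<^esub>"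
    and add: "\<And>x y. \<lbrakk>x \<in> carrier M; y \<in> carrier M\<rbrakk> \<Longrightarrow> x \<oplus>\<^bsub>M\<^esub> y \<in> carrier M"
    and smult: "\<And>a x. \<lbrakk>a \<in> carrier R; x \<in> carrier M\<rbrakk> \<Longrightarrow> a \<odot>\<^bsub>M\<^esub> x \<in> carrier M"
    and mult: "\<And>x y. \<lbrakk>x \<in> carrier M; y \<in> carrier M\<rbrakk> \<Longrightarrow> x \<otimes>\<^bsub>M\<^esub> y \<in> carrier M"
    and der: "\<And>x. x \<in> carrier M \<Longrightarrow> D x \<in> carrier M"
  shows "regular_preLieDer R M D"
proof -
  interpret N: regular_preLieDer R N E by (rule N)
  have lin: "linear_map R M N h"
    and h_mult: "\<And>x y. \<lbrakk>x \<in> carrier M; y \<in> carrier M\<rbrakk> \<Longrightarrow> h (x \<otimes>\<^bsub>M\<^esub> y) = h x \<otimes>\<^bsub>N\<^esub> h y"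
    and h_der: "\<And>x. x \<in> carrier M \<Longrightarrow> h (D x) = E (h x)"
    using hom by (auto simp: preLieDer_hom_def)
  have eqI: "x = y" if "h x = h y" "x \<in> carrier M" "y \<in> carrier M" for x y
    using inj_onD[OF inj] that by auto
  note h = linear_map_closed[OF lin] linear_map_add[OF lin] linear_map_smult[OF lin] h_mult h_der zero(2)
  note closed = zero(1) add smult mult der
  have E: "linear_map R N N E"
    by (rule N.D_linear)
  have "abelian_group M"
  proof (rule abelian_groupI)
    fix x assume x: "x \<in> carrier M"
    \<comment> \<open>Negation is not among the operations that \<open>h\<close> is assumed to
      respect, so the additive inverse is produced as the scalar multiple by -1.\<close>
    have "h ((\<ominus>\<^bsub>R\<^esub> \<one>\<^bsub>R\<^esub>) \<odot>\<^bsub>M\<^esub> x \<oplus>\<^bsub>M\<^esub> x) = h \<zero>\<^bsub>M\<^esub>"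
      using x by (simp add: closed h N.smult_l_minus N.M.l_neg)
    then have "(\<ominus>\<^bsub>R\<^esub> \<one>\<^bsub>R\<^esub>) \<odot>\<^bsub>M\<^esub> x \<oplus>\<^bsub>M\<^esub> x = \<zero>\<^bsub>M\<^esub>"
      by (rule eqI) (simp_all add: closed x)
    then show "\<exists>y\<in>carrier M. y \<oplus>\<^bsub>M\<^esub> x = \<zero>\<^bsub>M\<^esub>"
      using x by (intro bexI[of _ "(\<ominus>\<^bsub>R\<^esub> \<one>\<^bsub>R\<^esub>) \<odot>\<^bsub>M\<^esub> x"]) (simp_all add: closed)
  qed (simp_all add: closed, (rule eqI; simp add: closed h N.M.a_ac)+)
  then have M: "module R M"
    by (intro moduleI N.is_cring)
      (simp_all add: closed,
       (rule eqI; simp add: closed h N.smult_l_distr N.smult_r_distr N.smult_assoc1)+)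
  interpret M: module R M by (rule M)
  \<comment> \<open>Differences can be transported only from here on, since this needs
    \<open>M\<close> to be a module; left symmetry, which is stated with differences, therefore
    comes after it.\<close>
  note h_minus = linear_map_minus[OF lin M N.G_module]
  have left: "linear_map R M M (\<lambda>x. x \<otimes>\<^bsub>M\<^esub> y)" if "y \<in> carrier M" for y
    using that by (intro linear_mapI) (simp add: closed, (rule eqI; simp add: closed h N.product_bilinear)+)
  have right: "linear_map R M M (\<lambda>y. x \<otimes>\<^bsub>M\<^esub> y)" if "x \<in> carrier M" for x
    using that by (intro linear_mapI) (simp add: closed, (rule eqI; simp add: closed h N.product_bilinear)+)
  have D: "linear_map R M M D"
    by (intro linear_mapI)
      (simp add: closed, (rule eqI; simp add: closed h linear_map_add[OF E] linear_map_smult[OF E])+)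
  show ?thesis
  proof (intro regular_preLieDer.intro pre_lie_algebra.intro pre_lie_algebra_axioms.intro
      regular_preLieDer_axioms.intro N.field_axioms M left right D)
    fix x y z assume xyz: "x \<in> carrier M" "y \<in> carrier M" "z \<in> carrier M"
    show "(x \<otimes>\<^bsub>M\<^esub> y) \<otimes>\<^bsub>M\<^esub> z \<ominus>\<^bsub>M\<^esub> x \<otimes>\<^bsub>M\<^esub> (y \<otimes>\<^bsub>M\<^esub> z) =
        (y \<otimes>\<^bsub>M\<^esub> x) \<otimes>\<^bsub>M\<^esub> z \<ominus>\<^bsub>M\<^esub> y \<otimes>\<^bsub>M\<^esub> (x \<otimes>\<^bsub>M\<^esub> z)"
      by (rule eqI) (simp_all add: xyz closed h h_minus N.left_symmetric)
  next
    fix x y assume xy: "x \<in> carrier M" "y \<in> carrier M"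
    show "D (x \<otimes>\<^bsub>M\<^esub> y) = x \<otimes>\<^bsub>M\<^esub> D y \<oplus>\<^bsub>M\<^esub> D x \<otimes>\<^bsub>M\<^esub> y"
      by (rule eqI) (simp_all add: xy closed h N.D_product)
  qed
qed

section \<open>The twisted semidirect product and its axioms\<close>

context preLieDer_representation begin

definition twisted :: "('c list \<Rightarrow> 'e) \<Rightarrow> ('a, 'c \<times> 'e) module" where
  "twisted f =
    \<lparr>carrier = carrier G \<times> carrier V,
     monoid.mult = (\<lambda>(x, u) (y, v). (x \<otimes>\<^bsub>G\<^esub> y, f [x, y] \<oplus>\<^bsub>V\<^esub> \<rho> x v \<oplus>\<^bsub>V\<^esub> \<mu> y u)),
     one = (\<zero>\<^bsub>G\<^esub>, \<zero>\<^bsub>V\<^esub>),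
     ring.zero = (\<zero>\<^bsub>G\<^esub>, \<zero>\<^bsub>V\<^esub>),
     add = (\<lambda>(x, u) (y, v). (x \<oplus>\<^bsub>G\<^esub> y, u \<oplus>\<^bsub>V\<^esub> v)),
     smult = (\<lambda>a (x, u). (a \<odot>\<^bsub>G\<^esub> x, a \<odot>\<^bsub>V\<^esub> u))\<rparr>"

definition twisted_der :: "('c list \<Rightarrow> 'e) \<Rightarrow> 'c \<times> 'e \<Rightarrow> 'c \<times> 'e" where
  "twisted_der \<theta> = (\<lambda>(x, u). (D x, \<theta> [x] \<oplus>\<^bsub>V\<^esub> K u))"

lemma twisted_simps [simp]:
  "carrier (twisted f) = carrier G \<times> carrier V"
  "(x, u) \<otimes>\<^bsub>twisted f\<^esub> (y, v) = (x \<otimes>\<^bsub>G\<^esub> y, f [x, y] \<oplus>\<^bsub>V\<^esub> \<rho> x v \<oplus>\<^bsub>V\<^esub> \<mu> y u)"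
  "\<zero>\<^bsub>twisted f\<^esub> = (\<zero>\<^bsub>G\<^esub>, \<zero>\<^bsub>V\<^esub>)"
  "(x, u) \<oplus>\<^bsub>twisted f\<^esub> (y, v) = (x \<oplus>\<^bsub>G\<^esub> y, u \<oplus>\<^bsub>V\<^esub> v)"
  "a \<odot>\<^bsub>twisted f\<^esub> (x, u) = (a \<odot>\<^bsub>G\<^esub> x, a \<odot>\<^bsub>V\<^esub> u)"
  "twisted_der \<theta> (x, u) = (D x, \<theta> [x] \<oplus>\<^bsub>V\<^esub> K u)"
  by (simp_all add: twisted_def twisted_der_def)

lemma twisted_module: "module R (twisted f)"
proof (rule moduleI)
  show "abelian_group (twisted f)"
  proof (rule abelian_groupI)
    fix a assume "a \<in> carrier (twisted f)"
    then obtain x u where "a = (x, u)" "x \<in> carrier G" "u \<in> carrier V"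
      by auto
    then show "\<exists>b\<in>carrier (twisted f). b \<oplus>\<^bsub>twisted f\<^esub> a = \<zero>\<^bsub>twisted f\<^esub>"
      by (intro bexI[of _ "(\<ominus>\<^bsub>G\<^esub> x, \<ominus>\<^bsub>V\<^esub> u)"]) (simp_all add: M.l_neg V.M.l_neg)
  qed (auto simp: M.a_ac V.M.a_ac)
qed (auto simp: smult_l_distr smult_r_distr smult_assoc1 V.smult_l_distr V.smult_r_distr
    V.smult_assoc1 intro: is_cring)

lemma twisted_minus:
  assumes "x \<in> carrier G" "u \<in> carrier V" "y \<in> carrier G" "v \<in> carrier V"
  shows "(x, u) \<ominus>\<^bsub>twisted f\<^esub> (y, v) = (x \<ominus>\<^bsub>G\<^esub> y, u \<ominus>\<^bsub>V\<^esub> v)"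
proof -
  interpret T: module R "twisted f"
    by (rule twisted_module)
  have "(x \<ominus>\<^bsub>G\<^esub> y, u \<ominus>\<^bsub>V\<^esub> v) \<oplus>\<^bsub>twisted f\<^esub> (y, v) = (x, u)"
    using assms by (simp add: M.add_minus_cancel_right V.M.add_minus_cancel_right)
  then show ?thesis
    using assms by (subst T.M.minus_closed_eq_iff) simp_all
qed

lemma twisted_regular_preLieDer:
  assumes "(f, \<theta>) \<in> cocycles R G D V K \<rho> \<mu> 2"
  shows "regular_preLieDer R (twisted f) (twisted_der \<theta>)"
proof -
  have f: "f \<in> hom_space R G V 2" and \<theta>: "\<theta> \<in> hom_space R G V 1"
    and cocycle: "\<And>x y z. \<lbrakk>x \<in> carrier G; y \<in> carrier G; z \<in> carrier G\<rbrakk> \<Longrightarrow>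
      (f [x \<otimes>\<^bsub>G\<^esub> y, z] \<oplus>\<^bsub>V\<^esub> \<mu> z (f [x, y])) \<ominus>\<^bsub>V\<^esub> (f [x, y \<otimes>\<^bsub>G\<^esub> z] \<oplus>\<^bsub>V\<^esub> \<rho> x (f [y, z])) =
      (f [y \<otimes>\<^bsub>G\<^esub> x, z] \<oplus>\<^bsub>V\<^esub> \<mu> z (f [y, x])) \<ominus>\<^bsub>V\<^esub> (f [y, x \<otimes>\<^bsub>G\<^esub> z] \<oplus>\<^bsub>V\<^esub> \<rho> y (f [x, z]))"
    and der_cocycle: "\<And>x y. \<lbrakk>x \<in> carrier G; y \<in> carrier G\<rbrakk> \<Longrightarrow>
      \<theta> [x \<otimes>\<^bsub>G\<^esub> y] \<oplus>\<^bsub>V\<^esub> K (f [x, y]) =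
      \<rho> x (\<theta> [y]) \<oplus>\<^bsub>V\<^esub> \<mu> y (\<theta> [x]) \<oplus>\<^bsub>V\<^esub> (f [D x, y] \<oplus>\<^bsub>V\<^esub> f [x, D y])"
    using assms unfolding cocycles_2_iff by auto
  note val = hom_space_2D(4)[OF f] hom_space_1D(3)[OF \<theta>]
  note bilin = linear_map_add[OF hom_space_2D(2)[OF f]] linear_map_add[OF hom_space_2D(3)[OF f]]
    linear_map_smult[OF hom_space_2D(2)[OF f]] linear_map_smult[OF hom_space_2D(3)[OF f]]
    linear_map_add[OF hom_space_1D(2)[OF \<theta>]] linear_map_smult[OF hom_space_1D(2)[OF \<theta>]]
    action_bilinear product_bilinear der_linear
  show ?thesis
  proof (intro regular_preLieDer.intro pre_lie_algebra.intro pre_lie_algebra_axioms.intro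
      regular_preLieDer_axioms.intro field_axioms twisted_module)
    fix b assume "b \<in> carrier (twisted f)"
    then show "linear_map R (twisted f) (twisted f) (\<lambda>a. a \<otimes>\<^bsub>twisted f\<^esub> b)"
      and "linear_map R (twisted f) (twisted f) (\<lambda>a. b \<otimes>\<^bsub>twisted f\<^esub> a)"
      by (auto intro!: linear_mapI simp: val bilin V.M.a_ac V.smult_r_distr)
  next
    show "linear_map R (twisted f) (twisted f) (twisted_der \<theta>)"
      by (rule linear_mapI) (auto simp: val bilin V.M.a_ac V.smult_r_distr)
  next
    fix a b c assume "a \<in> carrier (twisted f)" "b \<in> carrier (twisted f)" "c \<in> carrier (twisted f)"
    then obtain x u y v z w where abc: "a = (x, u)" "b = (y, v)" "c = (z, w)"
      and G: "x \<in> carrier G" "y \<in> carrier G" "z \<in> carrier G"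
      and V: "u \<in> carrier V" "v \<in> carrier V" "w \<in> carrier V"
      by auto
    \<comment> \<open>The commutator axiom for \<rho>, regrouped so that each side is the w-part of
      one of the two associators.\<close>
    have commute: "\<rho> (x \<otimes>\<^bsub>G\<^esub> y) w \<ominus>\<^bsub>V\<^esub> \<rho> x (\<rho> y w) = \<rho> (y \<otimes>\<^bsub>G\<^esub> x) w \<ominus>\<^bsub>V\<^esub> \<rho> y (\<rho> x w)"
    proof -
      have "\<rho> (x \<otimes>\<^bsub>G\<^esub> y) w \<ominus>\<^bsub>V\<^esub> \<rho> (y \<otimes>\<^bsub>G\<^esub> x) w = \<rho> x (\<rho> y w) \<ominus>\<^bsub>V\<^esub> \<rho> y (\<rho> x w)"
        using \<rho>_commutator[OF G(1,2) V(3)] G V by (simp add: commutator_def action_minus)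
      then show ?thesis
        using G V by (simp add: V.M.minus_eq_minus_iff V.M.a_comm)
    qed
    \<comment> \<open>After sorting, the cochain terms agree by the cocycle equation and the w-terms
      by \<open>commute\<close>. The axiom for \<mu> acts crosswise: it matches the v-part
      \<open>\<mu> z (\<rho> x v) - \<rho> x (\<mu> z v)\<close> with the v-part
      \<open>\<mu> z (\<mu> x v) - \<mu> (x z) v\<close> of the exchanged associator, and likewise
      for u. Hence the final swap of two summands.\<close>
    have "f [x \<otimes>\<^bsub>G\<^esub> y, z] \<oplus>\<^bsub>V\<^esub> \<rho> (x \<otimes>\<^bsub>G\<^esub> y) w \<oplus>\<^bsub>V\<^esub>
          (\<mu> z (f [x, y]) \<oplus>\<^bsub>V\<^esub> \<mu> z (\<rho> x v) \<oplus>\<^bsub>V\<^esub> \<mu> z (\<mu> y u)) \<ominus>\<^bsub>V\<^esub>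
        (f [x, y \<otimes>\<^bsub>G\<^esub> z] \<oplus>\<^bsub>V\<^esub> (\<rho> x (f [y, z]) \<oplus>\<^bsub>V\<^esub> \<rho> x (\<rho> y w) \<oplus>\<^bsub>V\<^esub> \<rho> x (\<mu> z v)) \<oplus>\<^bsub>V\<^esub>
          \<mu> (y \<otimes>\<^bsub>G\<^esub> z) u) =
        f [y \<otimes>\<^bsub>G\<^esub> x, z] \<oplus>\<^bsub>V\<^esub> \<rho> (y \<otimes>\<^bsub>G\<^esub> x) w \<oplus>\<^bsub>V\<^esub>
          (\<mu> z (f [y, x]) \<oplus>\<^bsub>V\<^esub> \<mu> z (\<rho> y u) \<oplus>\<^bsub>V\<^esub> \<mu> z (\<mu> x v)) \<ominus>\<^bsub>V\<^esub>
        (f [y, x \<otimes>\<^bsub>G\<^esub> z] \<oplus>\<^bsub>V\<^esub> (\<rho> y (f [x, z]) \<oplus>\<^bsub>V\<^esub> \<rho> y (\<rho> x w) \<oplus>\<^bsub>V\<^esub> \<rho> y (\<mu> z u)) \<oplus>\<^bsub>V\<^esub>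
          \<mu> (x \<otimes>\<^bsub>G\<^esub> z) v)"
      using G V
      by (simp add: V.M.twisted_associator_arith val cocycle[OF G] commute \<mu>_product[symmetric]
          V.M.a_comm[of "\<mu> z (\<mu> x v) \<ominus>\<^bsub>V\<^esub> \<mu> (x \<otimes>\<^bsub>G\<^esub> z) v"])
    then show "(a \<otimes>\<^bsub>twisted f\<^esub> b) \<otimes>\<^bsub>twisted f\<^esub> c \<ominus>\<^bsub>twisted f\<^esub> a \<otimes>\<^bsub>twisted f\<^esub> (b \<otimes>\<^bsub>twisted f\<^esub> c) =
      (b \<otimes>\<^bsub>twisted f\<^esub> a) \<otimes>\<^bsub>twisted f\<^esub> c \<ominus>\<^bsub>twisted f\<^esub> b \<otimes>\<^bsub>twisted f\<^esub> (a \<otimes>\<^bsub>twisted f\<^esub> c)"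
      using G V by (simp add: abc twisted_minus val action_bilinear left_symmetric)
  next
    fix a b assume "a \<in> carrier (twisted f)" "b \<in> carrier (twisted f)"
    then obtain x u y v where ab: "a = (x, u)" "b = (y, v)"
      and G: "x \<in> carrier G" "y \<in> carrier G" and V: "u \<in> carrier V" "v \<in> carrier V"
      by auto
    \<comment> \<open>The bracketing isolates the left side of the second cocycle equation; the
      other two terms are then expanded by \<open>K_\<rho>\<close> and
      \<open>K_\<mu>\<close>.\<close>
    have "\<theta> [x \<otimes>\<^bsub>G\<^esub> y] \<oplus>\<^bsub>V\<^esub> K (f [x, y] \<oplus>\<^bsub>V\<^esub> \<rho> x v \<oplus>\<^bsub>V\<^esub> \<mu> y u) =
        (\<theta> [x \<otimes>\<^bsub>G\<^esub> y] \<oplus>\<^bsub>V\<^esub> K (f [x, y])) \<oplus>\<^bsub>V\<^esub> K (\<rho> x v) \<oplus>\<^bsub>V\<^esub> K (\<mu> y u)"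
      using G V by (simp add: val der_linear V.M.a_assoc)
    also have "\<dots> = f [x, D y] \<oplus>\<^bsub>V\<^esub> \<rho> x (\<theta> [y] \<oplus>\<^bsub>V\<^esub> K v) \<oplus>\<^bsub>V\<^esub> \<mu> (D y) u \<oplus>\<^bsub>V\<^esub>
        (f [D x, y] \<oplus>\<^bsub>V\<^esub> \<rho> (D x) v \<oplus>\<^bsub>V\<^esub> \<mu> y (\<theta> [x] \<oplus>\<^bsub>V\<^esub> K u))"
      using G V by (simp add: der_cocycle[OF G] K_\<rho> K_\<mu> val action_bilinear V.M.a_ac)
    finally show "twisted_der \<theta> (a \<otimes>\<^bsub>twisted f\<^esub> b) =
      a \<otimes>\<^bsub>twisted f\<^esub> twisted_der \<theta> b \<oplus>\<^bsub>twisted f\<^esub> twisted_der \<theta> a \<otimes>\<^bsub>twisted f\<^esub> b"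
      using G V by (simp add: ab D_product)
  qed
qed

lemmas action_zero =
  linear_map_zero[OF \<rho>_endo V_module V_module] linear_map_zero[OF \<mu>_endo V_module V_module]
  linear_map_zero[OF \<rho>_linear G_module V_module] linear_map_zero[OF \<mu>_linear G_module V_module]

text \<open>On pairs with zero V-entry all action terms in u, v, w vanish, and the axioms of the
  twisted product reduce to the two cocycle equations.\<close>

lemma cocycle_of_twisted_regular_preLieDer:
  assumes f: "f \<in> hom_space R G V 2" and \<theta>: "\<theta> \<in> hom_space R G V 1"
    and "regular_preLieDer R (twisted f) (twisted_der \<theta>)"
  shows "(f, \<theta>) \<in> cocycles R G D V K \<rho> \<mu> 2"
proof -
  interpret T: regular_preLieDer R "twisted f" "twisted_der \<theta>"
    by fact
  note val = hom_space_2D(4)[OF f] hom_space_1D(3)[OF \<theta>]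
  have "(f [x \<otimes>\<^bsub>G\<^esub> y, z] \<oplus>\<^bsub>V\<^esub> \<mu> z (f [x, y])) \<ominus>\<^bsub>V\<^esub> (f [x, y \<otimes>\<^bsub>G\<^esub> z] \<oplus>\<^bsub>V\<^esub> \<rho> x (f [y, z])) =
      (f [y \<otimes>\<^bsub>G\<^esub> x, z] \<oplus>\<^bsub>V\<^esub> \<mu> z (f [y, x])) \<ominus>\<^bsub>V\<^esub> (f [y, x \<otimes>\<^bsub>G\<^esub> z] \<oplus>\<^bsub>V\<^esub> \<rho> y (f [x, z]))"
    if "x \<in> carrier G" "y \<in> carrier G" "z \<in> carrier G" for x y z
    using T.left_symmetric[of "(x, \<zero>\<^bsub>V\<^esub>)" "(y, \<zero>\<^bsub>V\<^esub>)" "(z, \<zero>\<^bsub>V\<^esub>)"] that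
    by (simp add: twisted_minus val action_zero)
  moreover have "\<rho> x (\<theta> [y]) \<oplus>\<^bsub>V\<^esub> \<mu> y (\<theta> [x]) \<oplus>\<^bsub>V\<^esub> (f [D x, y] \<oplus>\<^bsub>V\<^esub> f [x, D y]) =
      \<theta> [x \<otimes>\<^bsub>G\<^esub> y] \<oplus>\<^bsub>V\<^esub> K (f [x, y])"
    if "x \<in> carrier G" "y \<in> carrier G" for x y
    using T.D_product[of "(x, \<zero>\<^bsub>V\<^esub>)" "(y, \<zero>\<^bsub>V\<^esub>)"] that
    by (simp add: val action_zero linear_map_zero[OF K_linear V_module V_module] V.M.a_ac)
  ultimately show ?thesis
    unfolding cocycles_2_iff using f \<theta> by blast
qed

end


section \<open>Extensions with a section\<close>

text \<open>One extension with one section. Two sections of an extension, or two extensions, are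
  compared by interpreting the locale a second time.\<close>

locale extension_section =
  preLieDer_representation R G D V K \<rho> \<mu>
  for R :: "'k ring" (structure) and G :: "('k, 'g) module" (structure) and D
    and V :: "('k, 'v) module" (structure) and K and \<rho> and \<mu> +
  fixes E :: "('k, 'u, 'g, 'v) extension" and s
  assumes ext: "E \<in> Defs.extensions R G D V K \<rho> \<mu>"
    and sec: "linear_section R G E s"
begin

sublocale T: regular_preLieDer R "total E" "der E"
  using ext by (simp add: Defs.extensions_def abelian_extension_def)

lemma incl_linear: "linear_map R V (total E) (incl E)"
  using ext
  by (simp add: Defs.extensions_def abelian_extension_def preLieDer_hom_def linear_map_def zero_product_def)

lemma incl_inj: "inj_on (incl E) (carrier V)"
  using ext by (simp add: Defs.extensions_def abelian_extension_def)

lemma proj_hom: "preLieDer_hom R (total E) (der E) G D (proj E)"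
  using ext by (simp add: Defs.extensions_def abelian_extension_def)

lemma proj_linear: "linear_map R (total E) G (proj E)"
  using proj_hom by (simp add: preLieDer_hom_def)

lemma incl_image: "incl E ` carrier V = {e \<in> carrier (total E). proj E e = \<zero>\<^bsub>G\<^esub>}"
  using ext by (simp add: Defs.extensions_def abelian_extension_def)

lemma section_linear: "linear_map R G (total E) s"
  using sec by (simp add: linear_section_def)

lemma incl_eq_iff [simp]:
  "u \<in> carrier V \<Longrightarrow> v \<in> carrier V \<Longrightarrow> incl E u = incl E v \<longleftrightarrow> u = v"
  using incl_inj by (auto dest: inj_onD)

lemma ext_closed [simp]:
  "u \<in> carrier V \<Longrightarrow> incl E u \<in> carrier (total E)"
  "x \<in> carrier G \<Longrightarrow> s x \<in> carrier (total E)"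
  "e \<in> carrier (total E) \<Longrightarrow> proj E e \<in> carrier G"
  "e \<in> carrier (total E) \<Longrightarrow> der E e \<in> carrier (total E)"
  using linear_map_closed[OF incl_linear] linear_map_closed[OF section_linear]
    linear_map_closed[OF proj_linear] linear_map_closed[OF T.D_linear] by blast+

lemma proj_simps [simp]:
  "x \<in> carrier G \<Longrightarrow> proj E (s x) = x"
  "u \<in> carrier V \<Longrightarrow> proj E (incl E u) = \<zero>\<^bsub>G\<^esub>"
  "e \<in> carrier (total E) \<Longrightarrow> e' \<in> carrier (total E) \<Longrightarrow>
    proj E (e \<otimes>\<^bsub>total E\<^esub> e') = proj E e \<otimes>\<^bsub>G\<^esub> proj E e'"
  "e \<in> carrier (total E) \<Longrightarrow> proj E (der E e) = D (proj E e)"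
  using sec incl_image proj_hom by (auto simp: linear_section_def preLieDer_hom_def)

lemmas incl_simps = linear_map_add[OF incl_linear] linear_map_smult[OF incl_linear]
  linear_map_minus[OF incl_linear V_module T.G_module] linear_map_zero[OF incl_linear V_module T.G_module]

lemmas section_simps = linear_map_add[OF section_linear] linear_map_smult[OF section_linear]
  linear_map_zero[OF section_linear G_module T.G_module]

lemmas proj_linear_simps = linear_map_add[OF proj_linear] linear_map_smult[OF proj_linear]
  linear_map_minus[OF proj_linear T.G_module G_module]

lemma incl_product:
  assumes "u \<in> carrier V" "v \<in> carrier V"
  shows "incl E u \<otimes>\<^bsub>total E\<^esub> incl E v = \<zero>\<^bsub>total E\<^esub>"
proof -
  have "preLieDer_hom R (zero_product V) K (total E) (der E) (incl E)"
    using ext by (simp add: Defs.extensions_def abelian_extension_def)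
  then have hom: "\<forall>u\<in>carrier (zero_product V). \<forall>v\<in>carrier (zero_product V).
      incl E (u \<otimes>\<^bsub>zero_product V\<^esub> v) = incl E u \<otimes>\<^bsub>total E\<^esub> incl E v"
    unfolding preLieDer_hom_def by (elim conjE)
  have u: "u \<in> carrier (zero_product V)" and v: "v \<in> carrier (zero_product V)"
    using assms by (simp_all add: zero_product_def)
  have "incl E (u \<otimes>\<^bsub>zero_product V\<^esub> v) = incl E u \<otimes>\<^bsub>total E\<^esub> incl E v"
    by (rule bspec[OF bspec[OF hom u] v])
  then show ?thesis
    by (simp add: zero_product_def incl_simps)
qed

lemma incl_der: "u \<in> carrier V \<Longrightarrow> der E (incl E u) = incl E (K u)"
  using ext
  by (simp add: Defs.extensions_def abelian_extension_def preLieDer_hom_def zero_product_def)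

lemma action:
  assumes "x \<in> carrier G" "u \<in> carrier V"
  shows "s x \<otimes>\<^bsub>total E\<^esub> incl E u = incl E (\<rho> x u)"
    "incl E u \<otimes>\<^bsub>total E\<^esub> s x = incl E (\<mu> x u)"
  using ext sec assms by (auto simp: Defs.extensions_def induces_def)

text \<open>Exactness: whatever lies over zero comes from V. This makes the \<open>inv_into\<close>
  in \<open>section_cochain\<close> a genuine preimage.\<close>

lemma inv_incl:
  assumes "e \<in> carrier (total E)" "proj E e = \<zero>\<^bsub>G\<^esub>"
  shows "inv_into (carrier V) (incl E) e \<in> carrier V"
    "incl E (inv_into (carrier V) (incl E) e) = e"
proof -
  have "e \<in> incl E ` carrier V"
    using assms by (simp add: incl_image)
  then show "inv_into (carrier V) (incl E) e \<in> carrier V"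
    "incl E (inv_into (carrier V) (incl E) e) = e"
    by (rule inv_into_into, rule f_inv_into_f)
qed

abbreviation "cocycle \<equiv> fst (section_cochain G D V E s)"
abbreviation "der_cocycle \<equiv> snd (section_cochain G D V E s)"

lemma cocycle_closed [simp]:
  assumes "x \<in> carrier G" "y \<in> carrier G"
  shows "cocycle [x, y] \<in> carrier V"
  using assms
  by (auto simp: section_cochain_def tuples_def proj_linear_simps M.r_neg a_minus_def[of G]
      intro!: inv_incl(1))

lemma der_cocycle_closed [simp]:
  assumes "x \<in> carrier G"
  shows "der_cocycle [x] \<in> carrier V"
  using assms
  by (auto simp: section_cochain_def tuples_def proj_linear_simps M.r_neg a_minus_def[of G]
      intro!: inv_incl(1))

text \<open>The defining equation of the cochain solved for the product. In this additive form,
  products of sections can be expanded in \<open>total E\<close> without subtraction.\<close>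

lemma section_product:
  assumes "x \<in> carrier G" "y \<in> carrier G"
  shows "s x \<otimes>\<^bsub>total E\<^esub> s y = s (x \<otimes>\<^bsub>G\<^esub> y) \<oplus>\<^bsub>total E\<^esub> incl E (cocycle [x, y])"
proof -
  have "incl E (cocycle [x, y]) = s x \<otimes>\<^bsub>total E\<^esub> s y \<ominus>\<^bsub>total E\<^esub> s (x \<otimes>\<^bsub>G\<^esub> y)"
    using assms
    by (simp add: section_cochain_def tuples_def proj_linear_simps M.r_neg a_minus_def[of G] inv_incl(2))
  then show ?thesis
    using assms by (simp add: T.M.add_minus_cancel_right T.M.a_comm[of "s (x \<otimes>\<^bsub>G\<^esub> y)"])
qed

lemma section_der:
  assumes "x \<in> carrier G"
  shows "der E (s x) = s (D x) \<oplus>\<^bsub>total E\<^esub> incl E (der_cocycle [x])"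
proof -
  have "incl E (der_cocycle [x]) = der E (s x) \<ominus>\<^bsub>total E\<^esub> s (D x)"
    using assms
    by (simp add: section_cochain_def tuples_def proj_linear_simps M.r_neg a_minus_def[of G] inv_incl(2))
  then show ?thesis
    using assms by (simp add: T.M.add_minus_cancel_right T.M.a_comm[of "s (D x)"])
qed

text \<open>The additive equations determine the cochain: the section term cancels and
  \<open>incl E\<close> is injective. This identifies cochains for a changed section, for an
  isomorphic extension and for the extension built from a cocycle.\<close>

lemma section_cochain_eqI:
  assumes "f \<in> extensional (tuples G 2)" "\<theta> \<in> extensional (tuples G 1)"
    and "\<And>x y. \<lbrakk>x \<in> carrier G; y \<in> carrier G\<rbrakk> \<Longrightarrow> f [x, y] \<in> carrier V"
    and "\<And>x. x \<in> carrier G \<Longrightarrow> \<theta> [x] \<in> carrier V"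
    and "\<And>x y. \<lbrakk>x \<in> carrier G; y \<in> carrier G\<rbrakk> \<Longrightarrow>
      s x \<otimes>\<^bsub>total E\<^esub> s y = s (x \<otimes>\<^bsub>G\<^esub> y) \<oplus>\<^bsub>total E\<^esub> incl E (f [x, y])"
    and "\<And>x. x \<in> carrier G \<Longrightarrow> der E (s x) = s (D x) \<oplus>\<^bsub>total E\<^esub> incl E (\<theta> [x])"
  shows "section_cochain G D V E s = (f, \<theta>)"
proof -
  have "cocycle [x, y] = f [x, y]" if "x \<in> carrier G" "y \<in> carrier G" for x y
    using section_product[OF that] assms(5)[OF that] assms(3)[OF that] that
    by simp
  moreover have "der_cocycle [x] = \<theta> [x]" if "x \<in> carrier G" for x
    using section_der[OF that] assms(6)[OF that] assms(4)[OF that] that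
    by simp
  moreover have "cocycle \<in> extensional (tuples G 2)" "der_cocycle \<in> extensional (tuples G 1)"
    by (simp_all add: section_cochain_def)
  ultimately have "cocycle = f" "der_cocycle = \<theta>"
    using assms(1,2) by (auto intro!: extensionalityI simp: tuples_1[unfolded One_nat_def] tuples_2)
  then show ?thesis
    by (simp add: prod_eq_iff)
qed

definition assemble where
  "assemble = (\<lambda>(x, u). s x \<oplus>\<^bsub>total E\<^esub> incl E u)"

text \<open>The projection recovers x, and then cancellation recovers u. Conversely e - s (p e) lies
  over zero, hence comes from V, for every e.\<close>

lemma assemble_bij: "bij_betw assemble (carrier G \<times> carrier V) (carrier (total E))"
proof (rule bij_betw_imageI)
  show "inj_on assemble (carrier G \<times> carrier V)"
  proof (rule inj_onI, clarify)
    fix x u y v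
    assume G: "x \<in> carrier G" "y \<in> carrier G" and V: "u \<in> carrier V" "v \<in> carrier V"
      and eq: "assemble (x, u) = assemble (y, v)"
    have "proj E (assemble (x, u)) = x" "proj E (assemble (y, v)) = y"
      using G V by (simp_all add: assemble_def proj_linear_simps)
    then have "x = y"
      using eq by simp
    moreover have "u = v"
      using eq \<open>x = y\<close> G V by (simp add: assemble_def)
    ultimately show "x = y \<and> u = v" ..
  qed
  have "e \<in> assemble ` (carrier G \<times> carrier V)" if e: "e \<in> carrier (total E)" for e
  proof -
    let ?r = "e \<ominus>\<^bsub>total E\<^esub> s (proj E e)"
    have r: "?r \<in> carrier (total E)" "proj E ?r = \<zero>\<^bsub>G\<^esub>"
      using e by (simp_all add: proj_linear_simps M.r_neg a_minus_def[of G])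
    have "assemble (proj E e, inv_into (carrier V) (incl E) ?r) = e"
      using e inv_incl[OF r]
      by (simp add: assemble_def T.M.a_comm[of "s _"] T.M.add_minus_cancel_right)
    then show ?thesis
      using imageI[of _ _ assemble, OF SigmaI[OF ext_closed(3)[OF e] inv_incl(1)[OF r]]]
      by (simp only:)
  qed
  then show "assemble ` (carrier G \<times> carrier V) = carrier (total E)"
    by (auto simp: assemble_def)
qed

text \<open>A product such as s (x + x') s y is written in two ways, with the cochain taken at the
  sum and with it taken at each summand. Linearity of \<open>s\<close> makes the section terms
  equal; after cancelling them, injectivity of \<open>incl E\<close> leaves the linearity of the
  cochain.\<close>

lemma section_cochain_hom_space:
  "cocycle \<in> hom_space R G V 2" "der_cocycle \<in> hom_space R G V 1"
proof -
  have "linear_map R G V (\<lambda>x. cocycle [x, y])" if y: "y \<in> carrier G" for y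
  proof (rule linear_mapI)
    fix x x' assume x: "x \<in> carrier G" "x' \<in> carrier G"
    have "s ((x \<oplus>\<^bsub>G\<^esub> x') \<otimes>\<^bsub>G\<^esub> y) \<oplus>\<^bsub>total E\<^esub> incl E (cocycle [x \<oplus>\<^bsub>G\<^esub> x', y]) =
        s x \<otimes>\<^bsub>total E\<^esub> s y \<oplus>\<^bsub>total E\<^esub> s x' \<otimes>\<^bsub>total E\<^esub> s y"
      using x y by (simp add: section_product[symmetric] section_simps T.product_bilinear)
    also have "\<dots> = s ((x \<oplus>\<^bsub>G\<^esub> x') \<otimes>\<^bsub>G\<^esub> y) \<oplus>\<^bsub>total E\<^esub> incl E (cocycle [x, y] \<oplus>\<^bsub>V\<^esub> cocycle [x', y])"
      using x y by (simp add: section_product section_simps product_bilinear incl_simps T.M.a_ac)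
    finally show "cocycle [x \<oplus>\<^bsub>G\<^esub> x', y] = cocycle [x, y] \<oplus>\<^bsub>V\<^esub> cocycle [x', y]"
      using x y by simp
  next
    fix a x assume x: "a \<in> carrier R" "x \<in> carrier G"
    have "s ((a \<odot>\<^bsub>G\<^esub> x) \<otimes>\<^bsub>G\<^esub> y) \<oplus>\<^bsub>total E\<^esub> incl E (cocycle [a \<odot>\<^bsub>G\<^esub> x, y]) =
        a \<odot>\<^bsub>total E\<^esub> (s x \<otimes>\<^bsub>total E\<^esub> s y)"
      using x y by (simp add: section_product[symmetric] section_simps T.product_bilinear)
    also have "\<dots> = s ((a \<odot>\<^bsub>G\<^esub> x) \<otimes>\<^bsub>G\<^esub> y) \<oplus>\<^bsub>total E\<^esub> incl E (a \<odot>\<^bsub>V\<^esub> cocycle [x, y])"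
      using x y by (simp add: section_product section_simps product_bilinear incl_simps T.smult_r_distr)
    finally show "cocycle [a \<odot>\<^bsub>G\<^esub> x, y] = a \<odot>\<^bsub>V\<^esub> cocycle [x, y]"
      using x y by simp
  qed (simp add: y)
  moreover have "linear_map R G V (\<lambda>y. cocycle [x, y])" if x: "x \<in> carrier G" for x
  proof (rule linear_mapI)
    fix y y' assume y: "y \<in> carrier G" "y' \<in> carrier G"
    have "s (x \<otimes>\<^bsub>G\<^esub> (y \<oplus>\<^bsub>G\<^esub> y')) \<oplus>\<^bsub>total E\<^esub> incl E (cocycle [x, y \<oplus>\<^bsub>G\<^esub> y']) =
        s x \<otimes>\<^bsub>total E\<^esub> s y \<oplus>\<^bsub>total E\<^esub> s x \<otimes>\<^bsub>total E\<^esub> s y'"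
      using x y by (simp add: section_product[symmetric] section_simps T.product_bilinear)
    also have "\<dots> = s (x \<otimes>\<^bsub>G\<^esub> (y \<oplus>\<^bsub>G\<^esub> y')) \<oplus>\<^bsub>total E\<^esub> incl E (cocycle [x, y] \<oplus>\<^bsub>V\<^esub> cocycle [x, y'])"
      using x y by (simp add: section_product section_simps product_bilinear incl_simps T.M.a_ac)
    finally show "cocycle [x, y \<oplus>\<^bsub>G\<^esub> y'] = cocycle [x, y] \<oplus>\<^bsub>V\<^esub> cocycle [x, y']"
      using x y by simp
  next
    fix a y assume y: "a \<in> carrier R" "y \<in> carrier G"
    have "s (x \<otimes>\<^bsub>G\<^esub> (a \<odot>\<^bsub>G\<^esub> y)) \<oplus>\<^bsub>total E\<^esub> incl E (cocycle [x, a \<odot>\<^bsub>G\<^esub> y]) =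
        a \<odot>\<^bsub>total E\<^esub> (s x \<otimes>\<^bsub>total E\<^esub> s y)"
      using x y by (simp add: section_product[symmetric] section_simps T.product_bilinear)
    also have "\<dots> = s (x \<otimes>\<^bsub>G\<^esub> (a \<odot>\<^bsub>G\<^esub> y)) \<oplus>\<^bsub>total E\<^esub> incl E (a \<odot>\<^bsub>V\<^esub> cocycle [x, y])"
      using x y by (simp add: section_product section_simps product_bilinear incl_simps T.smult_r_distr)
    finally show "cocycle [x, a \<odot>\<^bsub>G\<^esub> y] = a \<odot>\<^bsub>V\<^esub> cocycle [x, y]"
      using x y by simp
  qed (simp add: x)
  moreover have "linear_map R G V (\<lambda>x. der_cocycle [x])"
  proof (rule linear_mapI)
    fix x x' assume x: "x \<in> carrier G" "x' \<in> carrier G"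
    have "s (D (x \<oplus>\<^bsub>G\<^esub> x')) \<oplus>\<^bsub>total E\<^esub> incl E (der_cocycle [x \<oplus>\<^bsub>G\<^esub> x']) =
        der E (s x) \<oplus>\<^bsub>total E\<^esub> der E (s x')"
      using x by (simp add: section_der[symmetric] section_simps linear_map_add[OF T.D_linear])
    also have "\<dots> = s (D (x \<oplus>\<^bsub>G\<^esub> x')) \<oplus>\<^bsub>total E\<^esub> incl E (der_cocycle [x] \<oplus>\<^bsub>V\<^esub> der_cocycle [x'])"
      using x by (simp add: section_der section_simps der_linear incl_simps T.M.a_ac)
    finally show "der_cocycle [x \<oplus>\<^bsub>G\<^esub> x'] = der_cocycle [x] \<oplus>\<^bsub>V\<^esub> der_cocycle [x']"
      using x by simp
  next
    fix a x assume x: "a \<in> carrier R" "x \<in> carrier G"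
    have "s (D (a \<odot>\<^bsub>G\<^esub> x)) \<oplus>\<^bsub>total E\<^esub> incl E (der_cocycle [a \<odot>\<^bsub>G\<^esub> x]) = a \<odot>\<^bsub>total E\<^esub> der E (s x)"
      using x by (simp add: section_der[symmetric] section_simps linear_map_smult[OF T.D_linear])
    also have "\<dots> = s (D (a \<odot>\<^bsub>G\<^esub> x)) \<oplus>\<^bsub>total E\<^esub> incl E (a \<odot>\<^bsub>V\<^esub> der_cocycle [x])"
      using x by (simp add: section_der section_simps der_linear incl_simps T.smult_r_distr)
    finally show "der_cocycle [a \<odot>\<^bsub>G\<^esub> x] = a \<odot>\<^bsub>V\<^esub> der_cocycle [x]"
      using x by simp
  qed simp
  moreover have "cocycle \<in> extensional (tuples G 2)" "der_cocycle \<in> extensional (tuples G 1)"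
    by (simp_all add: section_cochain_def)
  ultimately show "cocycle \<in> hom_space R G V 2" "der_cocycle \<in> hom_space R G V 1"
    using hom_space_1_iff[of G der_cocycle R V] by (auto simp: hom_space_2_iff)
qed

text \<open>Of the four terms of (s x + u)(s y + v), the first gives the product in G and the
  cochain, the mixed ones give \<rho> and \<mu>, and u v is zero. Since \<open>preLieDer_hom\<close>
  demands no axioms of its source, this can be stated before the twisted product is known to be
  pre-Lie.\<close>

lemma assemble_hom:
  "preLieDer_hom R (twisted cocycle) (twisted_der der_cocycle) (total E) (der E) assemble"
proof -
  have "assemble (a \<otimes>\<^bsub>twisted cocycle\<^esub> b) = assemble a \<otimes>\<^bsub>total E\<^esub> assemble b"
    if a: "a \<in> carrier (twisted cocycle)" and b: "b \<in> carrier (twisted cocycle)" for a b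
  proof -
    obtain x u y v where ab: "a = (x, u)" "b = (y, v)"
      and GV: "x \<in> carrier G" "y \<in> carrier G" "u \<in> carrier V" "v \<in> carrier V"
      using a b by auto
    then show ?thesis
      by (simp add: assemble_def section_product incl_simps T.product_bilinear action incl_product T.M.a_ac)
  qed
  moreover have "assemble (twisted_der der_cocycle a) = der E (assemble a)"
    if "a \<in> carrier (twisted cocycle)" for a
    using that
    by (auto simp: assemble_def linear_map_add[OF T.D_linear] section_der incl_der incl_simps T.M.a_ac)
  moreover have "linear_map R (twisted cocycle) (total E) assemble"
    by (rule linear_mapI)
      (auto simp: assemble_def section_simps incl_simps T.M.a_ac T.smult_r_distr)
  ultimately show ?thesis
    unfolding preLieDer_hom_def by blast
qed

text \<open>The extension satisfies the axioms, so the twisted product inherits them through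
  \<open>assemble\<close>, and they contain the cocycle equations.\<close>

lemma section_cochain_cocycle: "section_cochain G D V E s \<in> cocycles R G D V K \<rho> \<mu> 2"
proof -
  have "regular_preLieDer R (twisted cocycle) (twisted_der der_cocycle)"
  proof (rule pullback_regular_preLieDer[OF T.regular_preLieDer_axioms assemble_hom])
    show "inj_on assemble (carrier (twisted cocycle))"
      using assemble_bij by (simp add: bij_betw_def)
  qed (auto simp: assemble_def section_simps incl_simps)
  from cocycle_of_twisted_regular_preLieDer[OF section_cochain_hom_space this]
  show ?thesis
    by (simp only: prod.collapse)
qed

end


section \<open>Comparing extensions\<close>

context extension_section begin

text \<open>Expanding (s x + \<phi> x)(s y + \<phi> y) and the derivation of s x + \<phi> x produces
  the action and \<open>K\<close> terms of \<phi>; rewriting s in terms of s' at x y and at D x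
  subtracts the remaining terms of the coboundary.\<close>

lemma change_section:
  assumes \<phi>: "\<phi> \<in> hom_space R G V 1" and "linear_section R G E s'"
    and s': "\<And>x. x \<in> carrier G \<Longrightarrow> s' x = s x \<oplus>\<^bsub>total E\<^esub> incl E (\<phi> [x])"
  shows "section_cochain G D V E s' =
    coboundary1 \<phi> \<otimes>\<^bsub>cochains R G V 2\<^esub> section_cochain G D V E s"
proof -
  interpret S: extension_section R G D V K \<rho> \<mu> E s'
    using ext assms(2) by unfold_locales
  define f where "f = (\<lambda>xs\<in>tuples G 2. fst (coboundary1 \<phi>) xs \<oplus>\<^bsub>V\<^esub> cocycle xs)"
  define \<theta> where "\<theta> = (\<lambda>xs\<in>tuples G 1. snd (coboundary1 \<phi>) xs \<oplus>\<^bsub>V\<^esub> der_cocycle xs)"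
  note val = hom_space_1D(3)[OF \<phi>]
  have f: "f [x, y] = \<rho> x (\<phi> [y]) \<oplus>\<^bsub>V\<^esub> \<mu> y (\<phi> [x]) \<ominus>\<^bsub>V\<^esub> \<phi> [x \<otimes>\<^bsub>G\<^esub> y] \<oplus>\<^bsub>V\<^esub> cocycle [x, y]"
    if "x \<in> carrier G" "y \<in> carrier G" for x y
    using that by (simp add: f_def coboundary1_apply) (simp add: tuples_def)
  have \<theta>: "\<theta> [x] = K (\<phi> [x]) \<ominus>\<^bsub>V\<^esub> \<phi> [D x] \<oplus>\<^bsub>V\<^esub> der_cocycle [x]" if "x \<in> carrier G" for x
    using that by (simp add: \<theta>_def coboundary1_apply) (simp add: tuples_def)
  have f_closed: "f [x, y] \<in> carrier V" if "x \<in> carrier G" "y \<in> carrier G" for x y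
    using that by (simp add: f val)
  have \<theta>_closed: "\<theta> [x] \<in> carrier V" if "x \<in> carrier G" for x
    using that by (simp add: \<theta> val)
  \<comment> \<open>The subtracted term of the coboundary is moved to the other side, so that the
    computation in \<open>total E\<close> involves sums only.\<close>
  have f_split: "incl E (\<rho> x (\<phi> [y])) \<oplus>\<^bsub>total E\<^esub> incl E (\<mu> y (\<phi> [x])) \<oplus>\<^bsub>total E\<^esub> incl E (cocycle [x, y]) =
      incl E (\<phi> [x \<otimes>\<^bsub>G\<^esub> y]) \<oplus>\<^bsub>total E\<^esub> incl E (f [x, y])"
    if "x \<in> carrier G" "y \<in> carrier G" for x y
  proof -
    have "\<rho> x (\<phi> [y]) \<oplus>\<^bsub>V\<^esub> \<mu> y (\<phi> [x]) \<oplus>\<^bsub>V\<^esub> cocycle [x, y] =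
        (\<rho> x (\<phi> [y]) \<oplus>\<^bsub>V\<^esub> \<mu> y (\<phi> [x]) \<ominus>\<^bsub>V\<^esub> \<phi> [x \<otimes>\<^bsub>G\<^esub> y] \<oplus>\<^bsub>V\<^esub> \<phi> [x \<otimes>\<^bsub>G\<^esub> y]) \<oplus>\<^bsub>V\<^esub> cocycle [x, y]"
      using that by (subst V.M.add_minus_cancel_right) (simp_all add: val)
    also have "\<dots> = \<phi> [x \<otimes>\<^bsub>G\<^esub> y] \<oplus>\<^bsub>V\<^esub> f [x, y]"
      unfolding f[OF that] using that by (simp add: val V.M.a_ac)
    finally show ?thesis
      using that by (simp add: incl_simps[symmetric] f_closed val)
  qed
  have \<theta>_split: "incl E (K (\<phi> [x])) \<oplus>\<^bsub>total E\<^esub> incl E (der_cocycle [x]) =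
      incl E (\<phi> [D x]) \<oplus>\<^bsub>total E\<^esub> incl E (\<theta> [x])"
    if "x \<in> carrier G" for x
  proof -
    have "K (\<phi> [x]) \<oplus>\<^bsub>V\<^esub> der_cocycle [x] =
        (K (\<phi> [x]) \<ominus>\<^bsub>V\<^esub> \<phi> [D x] \<oplus>\<^bsub>V\<^esub> \<phi> [D x]) \<oplus>\<^bsub>V\<^esub> der_cocycle [x]"
      using that by (subst V.M.add_minus_cancel_right) (simp_all add: val)
    also have "\<dots> = \<phi> [D x] \<oplus>\<^bsub>V\<^esub> \<theta> [x]"
      unfolding \<theta>[OF that] using that by (simp add: val V.M.a_ac)
    finally show ?thesis
      using that by (simp add: incl_simps[symmetric] \<theta>_closed val)
  qed
  have "section_cochain G D V E s' = (f, \<theta>)"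
  proof (rule S.section_cochain_eqI)
    fix x y assume G: "x \<in> carrier G" "y \<in> carrier G"
    show "f [x, y] \<in> carrier V"
      by (rule f_closed[OF G])
    have "s' x \<otimes>\<^bsub>total E\<^esub> s' y = s (x \<otimes>\<^bsub>G\<^esub> y) \<oplus>\<^bsub>total E\<^esub>
        (incl E (\<rho> x (\<phi> [y])) \<oplus>\<^bsub>total E\<^esub> incl E (\<mu> y (\<phi> [x])) \<oplus>\<^bsub>total E\<^esub> incl E (cocycle [x, y]))"
      using G by (simp add: s' val T.product_bilinear section_product action incl_product T.M.a_ac)
    also have "\<dots> = s' (x \<otimes>\<^bsub>G\<^esub> y) \<oplus>\<^bsub>total E\<^esub> incl E (f [x, y])"
      unfolding f_split[OF G] using G by (simp add: s' val f_closed T.M.a_assoc)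
    finally show "s' x \<otimes>\<^bsub>total E\<^esub> s' y = s' (x \<otimes>\<^bsub>G\<^esub> y) \<oplus>\<^bsub>total E\<^esub> incl E (f [x, y])" .
  next
    fix x assume G: "x \<in> carrier G"
    show "\<theta> [x] \<in> carrier V"
      by (rule \<theta>_closed[OF G])
    have "der E (s' x) = s (D x) \<oplus>\<^bsub>total E\<^esub> (incl E (K (\<phi> [x])) \<oplus>\<^bsub>total E\<^esub> incl E (der_cocycle [x]))"
      using G by (simp add: s' val linear_map_add[OF T.D_linear] section_der incl_der T.M.a_ac)
    also have "\<dots> = s' (D x) \<oplus>\<^bsub>total E\<^esub> incl E (\<theta> [x])"
      unfolding \<theta>_split[OF G] using G by (simp add: s' val \<theta>_closed T.M.a_assoc)
    finally show "der E (s' x) = s' (D x) \<oplus>\<^bsub>total E\<^esub> incl E (\<theta> [x])" .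
  qed (simp_all add: f_def \<theta>_def)
  then show ?thesis
    by (simp add: f_def \<theta>_def cochains_def hom_group_def mult_DirProd')
qed

text \<open>Adding values in V does not affect the projection. This allows a prescribed coboundary
  to be realised by a change of section.\<close>

lemma shifted_section:
  assumes \<phi>: "\<phi> \<in> hom_space R G V 1"
  shows "linear_section R G E (\<lambda>x. s x \<oplus>\<^bsub>total E\<^esub> incl E (\<phi> [x]))"
proof -
  note \<phi>_simps = hom_space_1D(3)[OF \<phi>] linear_map_add[OF hom_space_1D(2)[OF \<phi>]]
    linear_map_smult[OF hom_space_1D(2)[OF \<phi>]]
  have "linear_map R G (total E) (\<lambda>x. s x \<oplus>\<^bsub>total E\<^esub> incl E (\<phi> [x]))"
    by (rule linear_mapI)
      (simp_all add: \<phi>_simps section_simps incl_simps T.M.a_ac T.smult_r_distr)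
  then show ?thesis
    by (simp add: linear_section_def proj_linear_simps \<phi>_simps)
qed

text \<open>Two sections have the same projection, so their difference lies over zero and comes from
  V by exactness. Linearity of the difference is inherited from the two sections by
  cancellation.\<close>

lemma section_difference:
  assumes "linear_section R G E s'"
  shows "\<exists>\<phi>\<in>hom_space R G V 1. \<forall>x\<in>carrier G. s' x = s x \<oplus>\<^bsub>total E\<^esub> incl E (\<phi> [x])"
proof -
  interpret S: extension_section R G D V K \<rho> \<mu> E s'
    using ext assms by unfold_locales
  define \<phi> where
    "\<phi> = (\<lambda>xs\<in>tuples G 1. inv_into (carrier V) (incl E) (s' (xs ! 0) \<ominus>\<^bsub>total E\<^esub> s (xs ! 0)))"
  have diff: "s' x \<ominus>\<^bsub>total E\<^esub> s x \<in> carrier (total E)" "proj E (s' x \<ominus>\<^bsub>total E\<^esub> s x) = \<zero>\<^bsub>G\<^esub>"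
    if "x \<in> carrier G" for x
    using that by (simp_all add: proj_linear_simps M.minus_eq_zero_iff)
  have \<phi>: "\<phi> [x] \<in> carrier V" "incl E (\<phi> [x]) = s' x \<ominus>\<^bsub>total E\<^esub> s x" if "x \<in> carrier G" for x
    using that inv_incl[OF diff[OF that]] by (simp_all add: \<phi>_def tuples_def)
  have s': "s' x = s x \<oplus>\<^bsub>total E\<^esub> incl E (\<phi> [x])" if "x \<in> carrier G" for x
    using that by (simp add: \<phi> T.M.a_comm[of "s x"] T.M.add_minus_cancel_right)
  have "linear_map R G V (\<lambda>x. \<phi> [x])"
  proof (rule linear_mapI)
    fix x y assume G: "x \<in> carrier G" "y \<in> carrier G"
    have "s (x \<oplus>\<^bsub>G\<^esub> y) \<oplus>\<^bsub>total E\<^esub> incl E (\<phi> [x \<oplus>\<^bsub>G\<^esub> y]) = s' x \<oplus>\<^bsub>total E\<^esub> s' y"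
      using G by (simp add: s'[symmetric] S.section_simps)
    also have "\<dots> = s (x \<oplus>\<^bsub>G\<^esub> y) \<oplus>\<^bsub>total E\<^esub> incl E (\<phi> [x] \<oplus>\<^bsub>V\<^esub> \<phi> [y])"
      using G by (simp add: s' section_simps incl_simps \<phi>(1) T.M.a_ac)
    finally show "\<phi> [x \<oplus>\<^bsub>G\<^esub> y] = \<phi> [x] \<oplus>\<^bsub>V\<^esub> \<phi> [y]"
      using G by (simp add: \<phi>(1))
  next
    fix a x assume G: "a \<in> carrier R" "x \<in> carrier G"
    have "s (a \<odot>\<^bsub>G\<^esub> x) \<oplus>\<^bsub>total E\<^esub> incl E (\<phi> [a \<odot>\<^bsub>G\<^esub> x]) = a \<odot>\<^bsub>total E\<^esub> s' x"
      using G by (simp add: s'[symmetric] S.section_simps)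
    also have "\<dots> = s (a \<odot>\<^bsub>G\<^esub> x) \<oplus>\<^bsub>total E\<^esub> incl E (a \<odot>\<^bsub>V\<^esub> \<phi> [x])"
      using G by (simp add: s' section_simps incl_simps \<phi>(1) T.smult_r_distr)
    finally show "\<phi> [a \<odot>\<^bsub>G\<^esub> x] = a \<odot>\<^bsub>V\<^esub> \<phi> [x]"
      using G by (simp add: \<phi>(1))
  qed (rule \<phi>(1))
  moreover have "\<phi> \<in> extensional (tuples G 1)"
    by (simp add: \<phi>_def)
  ultimately have "\<phi> \<in> hom_space R G V 1"
    using hom_space_1_iff[of G \<phi> R V] by auto
  then show ?thesis
    using s' by blast
qed

lemma section_cochain_in_cochains: "section_cochain G D V E s \<in> carrier (cochains R G V 2)"
  using section_cochain_hom_space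
  by (cases "section_cochain G D V E s") (simp add: cochains_def hom_group_def)

lemma cohomology_class_section_independent:
  assumes "linear_section R G E s'"
  shows "cohomology_class R G D V K \<rho> \<mu> 2 (section_cochain G D V E s') =
    cohomology_class R G D V K \<rho> \<mu> 2 (section_cochain G D V E s)"
proof -
  interpret S: extension_section R G D V K \<rho> \<mu> E s'
    using ext assms by unfold_locales
  show ?thesis
    using section_difference[OF assms] change_section[OF _ assms]
    by (subst cohomology_class_eq_iff)
      (auto simp: section_cochain_in_cochains S.section_cochain_in_cochains)
qed

text \<open>An isomorphism of extensions is the identity on V and over G, so it carries the defining
  equations of the cochain over unchanged. The cochains are equal, not merely cohomologous.\<close>

lemma section_cochain_iso:
  assumes F: "F \<in> Defs.extensions R G D V K \<rho> \<mu>" and iso: "extension_iso R V E F \<zeta>"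
  shows "linear_section R G F (\<lambda>x. \<zeta> (s x))"
    "section_cochain G D V F (\<lambda>x. \<zeta> (s x)) = section_cochain G D V E s"
proof -
  have lin: "linear_map R (total E) (total F) \<zeta>"
    and mult: "\<And>e e'. e \<in> carrier (total E) \<Longrightarrow> e' \<in> carrier (total E) \<Longrightarrow>
      \<zeta> (e \<otimes>\<^bsub>total E\<^esub> e') = \<zeta> e \<otimes>\<^bsub>total F\<^esub> \<zeta> e'"
    and der: "\<And>e. e \<in> carrier (total E) \<Longrightarrow> \<zeta> (der E e) = der F (\<zeta> e)"
    and incl: "\<And>u. u \<in> carrier V \<Longrightarrow> \<zeta> (incl E u) = incl F u"
    and proj: "\<And>e. e \<in> carrier (total E) \<Longrightarrow> proj F (\<zeta> e) = proj E e"
    using iso by (auto simp: extension_iso_def preLieDer_hom_def)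
  note \<zeta> = linear_map_closed[OF lin] linear_map_add[OF lin] linear_map_smult[OF lin]
  have "linear_map R G (total F) (\<lambda>x. \<zeta> (s x))"
    by (rule linear_mapI) (simp_all add: section_simps \<zeta>)
  then show sec_F: "linear_section R G F (\<lambda>x. \<zeta> (s x))"
    by (simp add: linear_section_def proj)
  interpret F: extension_section R G D V K \<rho> \<mu> F "\<lambda>x. \<zeta> (s x)"
    using F sec_F by unfold_locales
  have "section_cochain G D V F (\<lambda>x. \<zeta> (s x)) = (cocycle, der_cocycle)"
  proof (rule F.section_cochain_eqI)
    show "\<zeta> (s x) \<otimes>\<^bsub>total F\<^esub> \<zeta> (s y) = \<zeta> (s (x \<otimes>\<^bsub>G\<^esub> y)) \<oplus>\<^bsub>total F\<^esub> incl F (cocycle [x, y])"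
      if "x \<in> carrier G" "y \<in> carrier G" for x y
      using that by (simp add: mult[symmetric] section_product \<zeta> incl)
    show "der F (\<zeta> (s x)) = \<zeta> (s (D x)) \<oplus>\<^bsub>total F\<^esub> incl F (der_cocycle [x])"
      if "x \<in> carrier G" for x
      using that by (simp add: der[symmetric] section_der \<zeta> incl)
  qed (use section_cochain_hom_space[THEN hom_space_extensional] in simp_all)
  then show "section_cochain G D V F (\<lambda>x. \<zeta> (s x)) = section_cochain G D V E s"
    by simp
qed

text \<open>Equal cochains give the same twisted product, onto which both extensions are unrolled;
  the isomorphism is \<open>F.assemble\<close> after the inverse of \<open>assemble\<close>. Each
  property is checked on elements written as \<open>assemble a\<close>.\<close>

lemma extension_iso_of_cochain_eq:
  assumes "extension_section R G D V K \<rho> \<mu> F t"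
    and eq: "section_cochain G D V F t = section_cochain G D V E s"
  shows "\<exists>\<zeta>. extension_iso R V E F \<zeta>"
proof -
  interpret F: extension_section R G D V K \<rho> \<mu> F t
    by fact
  let ?A = "carrier G \<times> carrier V"
  define \<zeta> where "\<zeta> e = F.assemble (inv_into ?A assemble e)" for e
  have \<zeta>: "\<zeta> (assemble a) = F.assemble a" if "a \<in> ?A" for a
    using bij_betw_inv_into_left[OF assemble_bij that] by (simp add: \<zeta>_def)
  have obtain_A: "\<exists>a\<in>?A. e = assemble a" if "e \<in> carrier (total E)" for e
  proof -
    have "e \<in> assemble ` ?A"
      using that by (simp only: bij_betw_imp_surj_on[OF assemble_bij])
    then show ?thesis
      by (simp only: image_iff)
  qed
  note hom = preLieDer_homD[OF assemble_hom, unfolded twisted_simps(1)]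
  \<comment> \<open>Unfolding \<open>eq\<close> replaces the cochain of \<open>t\<close> by that of
    \<open>s\<close>, so both homomorphisms start from literally the same structure.\<close>
  note hom_F = preLieDer_homD[OF F.assemble_hom, unfolded eq twisted_simps(1)]
  have closed: "a \<oplus>\<^bsub>twisted cocycle\<^esub> b \<in> ?A" "a \<otimes>\<^bsub>twisted cocycle\<^esub> b \<in> ?A"
    "twisted_der der_cocycle a \<in> ?A" if "a \<in> ?A" "b \<in> ?A" for a b
    using that by auto
  have closed_smult: "c \<odot>\<^bsub>twisted cocycle\<^esub> a \<in> ?A" if "c \<in> carrier R" "a \<in> ?A" for c a
    using that by auto
  have "preLieDer_hom R (total E) (der E) (total F) (der F) \<zeta>"
    unfolding preLieDer_hom_def
  proof (intro conjI ballI linear_mapI)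
    fix e assume "e \<in> carrier (total E)"
    then obtain a where a: "a \<in> ?A" "e = assemble a"
      using obtain_A by metis
    show "\<zeta> e \<in> carrier (total F)"
      using hom_F(1)[OF a(1)] a \<zeta> by simp
    have "der E e = assemble (twisted_der der_cocycle a)"
      using hom(5)[OF a(1)] a(2) by simp
    then show "\<zeta> (der E e) = der F (\<zeta> e)"
      using hom_F(5)[OF a(1)] \<zeta>[OF a(1)] \<zeta>[OF closed(3)[OF a(1) a(1)]] a(2) by simp
    show "\<zeta> (c \<odot>\<^bsub>total E\<^esub> e) = c \<odot>\<^bsub>total F\<^esub> \<zeta> e" if c: "c \<in> carrier R" for c
    proof -
      have "c \<odot>\<^bsub>total E\<^esub> e = assemble (c \<odot>\<^bsub>twisted cocycle\<^esub> a)"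
        using hom(3)[OF c a(1)] a(2) by simp
      then show ?thesis
        using hom_F(3)[OF c a(1)] \<zeta>[OF a(1)] \<zeta>[OF closed_smult[OF c a(1)]] a(2) by simp
    qed
    fix e' assume "e' \<in> carrier (total E)"
    then obtain b where b: "b \<in> ?A" "e' = assemble b"
      using obtain_A by metis
    have "e \<oplus>\<^bsub>total E\<^esub> e' = assemble (a \<oplus>\<^bsub>twisted cocycle\<^esub> b)"
      using hom(2)[OF a(1) b(1)] a(2) b(2) by simp
    then show "\<zeta> (e \<oplus>\<^bsub>total E\<^esub> e') = \<zeta> e \<oplus>\<^bsub>total F\<^esub> \<zeta> e'"
      using hom_F(2)[OF a(1) b(1)] \<zeta>[OF a(1)] \<zeta>[OF b(1)]
        \<zeta>[OF closed(1)[OF a(1) b(1)]] a(2) b(2)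
      by simp
    have "e \<otimes>\<^bsub>total E\<^esub> e' = assemble (a \<otimes>\<^bsub>twisted cocycle\<^esub> b)"
      using hom(4)[OF a(1) b(1)] a(2) b(2) by simp
    then show "\<zeta> (e \<otimes>\<^bsub>total E\<^esub> e') = \<zeta> e \<otimes>\<^bsub>total F\<^esub> \<zeta> e'"
      using hom_F(4)[OF a(1) b(1)] \<zeta>[OF a(1)] \<zeta>[OF b(1)]
        \<zeta>[OF closed(2)[OF a(1) b(1)]] a(2) b(2)
      by simp
  qed
  moreover have "bij_betw \<zeta> (carrier (total E)) (carrier (total F))"
    using bij_betw_trans[OF bij_betw_inv_into[OF assemble_bij] F.assemble_bij]
    by (simp add: \<zeta>_def[abs_def] comp_def)
  moreover have "\<zeta> (incl E u) = incl F u" if "u \<in> carrier V" for u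
  proof -
    have "incl E u = assemble (\<zero>\<^bsub>G\<^esub>, u)" "incl F u = F.assemble (\<zero>\<^bsub>G\<^esub>, u)"
      using that by (simp_all add: assemble_def F.assemble_def section_simps F.section_simps)
    then show ?thesis
      using that \<zeta>[of "(\<zero>\<^bsub>G\<^esub>, u)"] by simp
  qed
  moreover have "proj F (\<zeta> e) = proj E e" if e: "e \<in> carrier (total E)" for e
  proof -
    obtain x u where "x \<in> carrier G" "u \<in> carrier V" "e = assemble (x, u)"
      using obtain_A[OF e] by (metis SigmaE)
    then show ?thesis
      using \<zeta>[of "(x, u)"]
      by (simp add: assemble_def F.assemble_def proj_linear_simps F.proj_linear_simps)
  qed
  ultimately show ?thesis
    unfolding extension_iso_def by blast
qed

end


section \<open>Classification\<close>

context preLieDer_representation begin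

text \<open>The twisted product lives on pairs, whereas an extension must have its underlying set in
  \<open>'u\<close>. So the structure is copied to the image of \<open>j\<close>, with
  \<open>h\<close> as the way back.\<close>

definition twisted_extension ::
  "('c \<times> 'e \<Rightarrow> 'u) \<Rightarrow> ('c list \<Rightarrow> 'e) \<times> ('c list \<Rightarrow> 'e) \<Rightarrow> ('a, 'u, 'c, 'e) extension" where
  "twisted_extension j = (\<lambda>(f, \<theta>).
     let h = inv_into (carrier G \<times> carrier V) j in
     \<lparr>total =
       \<lparr>carrier = j ` (carrier G \<times> carrier V),
        monoid.mult = (\<lambda>a b. j (h a \<otimes>\<^bsub>twisted f\<^esub> h b)),
        one = j (\<zero>\<^bsub>G\<^esub>, \<zero>\<^bsub>V\<^esub>),
        ring.zero = j (\<zero>\<^bsub>G\<^esub>, \<zero>\<^bsub>V\<^esub>),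
        add = (\<lambda>a b. j (h a \<oplus>\<^bsub>twisted f\<^esub> h b)),
        smult = (\<lambda>c a. j (c \<odot>\<^bsub>twisted f\<^esub> h a))\<rparr>,
      der = (\<lambda>a. j (twisted_der \<theta> (h a))),
      incl = (\<lambda>u. j (\<zero>\<^bsub>G\<^esub>, u)),
      proj = (\<lambda>a. fst (h a))\<rparr>)"

end

text \<open>The source of surjectivity: a cocycle is realised exactly, as the cochain of a section,
  and not just up to a coboundary.\<close>

lemma twisted_extension_section:
  fixes R :: "'k ring" and G :: "('k, 'g) module" and V :: "('k, 'v) module"
    and j :: "'g \<times> 'v \<Rightarrow> 'u"
  assumes rep: "preLieDer_representation R G D V K \<rho> \<mu>"
    and j: "inj_on j (carrier G \<times> carrier V)"
    and cocycle: "(f, \<theta>) \<in> cocycles R G D V K \<rho> \<mu> 2"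
  shows "\<exists>E s. extension_section R G D V K \<rho> \<mu> (E :: ('k, 'u, 'g, 'v) extension) s \<and>
    section_cochain G D V E s = (f, \<theta>)"
proof -
  interpret preLieDer_representation R G D V K \<rho> \<mu>
    by (rule rep)
  define E where "E = twisted_extension j (f, \<theta>)"
  \<comment> \<open>The zero section. The product of (x, 0) and (y, 0) is (x y, f [x, y]) and the
    derivation sends (x, 0) to (D x, \<theta> [x]), so its cochain is (f, \<theta>).\<close>
  define s where "s x = j (x, \<zero>\<^bsub>V\<^esub>)" for x
  have f: "f \<in> hom_space R G V 2" and \<theta>: "\<theta> \<in> hom_space R G V 1"
    using cocycle unfolding cocycles_2_iff by auto
  note val = hom_space_2D(4)[OF f] hom_space_1D(3)[OF \<theta>]
  note zero = linear_map_zero[OF hom_space_2D(2)[OF f] G_module V_module]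
    linear_map_zero[OF hom_space_2D(3)[OF f] G_module V_module]
    linear_map_zero[OF hom_space_1D(2)[OF \<theta>] G_module V_module]
    linear_map_zero[OF D_linear G_module G_module] linear_map_zero[OF K_linear V_module V_module]
    linear_map_zero[OF product_linear_left G_module G_module]
    linear_map_zero[OF product_linear_right G_module G_module] action_zero
  have inv: "inv_into (carrier G \<times> carrier V) j (j (x, u)) = (x, u)"
    if "x \<in> carrier G" "u \<in> carrier V" for x u
    using that by (intro inv_into_f_f[OF j]) simp
  have E_simps [simp]:
    "carrier (total E) = j ` (carrier G \<times> carrier V)"
    "\<zero>\<^bsub>total E\<^esub> = j (\<zero>\<^bsub>G\<^esub>, \<zero>\<^bsub>V\<^esub>)"
    "\<lbrakk>x \<in> carrier G; u \<in> carrier V; y \<in> carrier G; v \<in> carrier V\<rbrakk> \<Longrightarrow>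
      j (x, u) \<otimes>\<^bsub>total E\<^esub> j (y, v) = j ((x, u) \<otimes>\<^bsub>twisted f\<^esub> (y, v))"
    "\<lbrakk>x \<in> carrier G; u \<in> carrier V; y \<in> carrier G; v \<in> carrier V\<rbrakk> \<Longrightarrow>
      j (x, u) \<oplus>\<^bsub>total E\<^esub> j (y, v) = j (x \<oplus>\<^bsub>G\<^esub> y, u \<oplus>\<^bsub>V\<^esub> v)"
    "\<lbrakk>x \<in> carrier G; u \<in> carrier V\<rbrakk> \<Longrightarrow>
      c \<odot>\<^bsub>total E\<^esub> j (x, u) = j (c \<odot>\<^bsub>G\<^esub> x, c \<odot>\<^bsub>V\<^esub> u)"
    "\<lbrakk>x \<in> carrier G; u \<in> carrier V\<rbrakk> \<Longrightarrow> der E (j (x, u)) = j (twisted_der \<theta> (x, u))"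
    "incl E u = j (\<zero>\<^bsub>G\<^esub>, u)"
    "\<lbrakk>x \<in> carrier G; u \<in> carrier V\<rbrakk> \<Longrightarrow> proj E (j (x, u)) = x"
    for x u y v c
    by (simp_all add: E_def twisted_extension_def Let_def inv)
  have j_eq: "j (x, u) = j (y, v) \<longleftrightarrow> x = y \<and> u = v"
    if "x \<in> carrier G" "u \<in> carrier V" "y \<in> carrier G" "v \<in> carrier V" for x u y v
    using inj_on_eq_iff[OF j, of "(x, u)" "(y, v)"] that by simp
  let ?h = "inv_into (carrier G \<times> carrier V) j"
  have "regular_preLieDer R (total E) (der E)"
  \<comment> \<open>The pullback goes along the inverse of \<open>j\<close>, from the copy back to
    the twisted product, where the axioms are known.\<close>
  proof (rule pullback_regular_preLieDer[OF twisted_regular_preLieDer[OF cocycle], where h = ?h])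
    show "preLieDer_hom R (total E) (der E) (twisted f) (twisted_der \<theta>) ?h"
      by (auto simp: preLieDer_hom_def linear_map_def inv val)
    show "inj_on ?h (carrier (total E))"
      by (auto intro!: inj_onI simp: inv j_eq)
  qed (auto simp: inv val)
  moreover have "preLieDer_hom R (zero_product V) K (total E) (der E) (incl E)"
    by (auto simp: preLieDer_hom_def linear_map_def zero_product_def zero val)
  moreover have "preLieDer_hom R (total E) (der E) G D (proj E)"
    by (auto simp: preLieDer_hom_def linear_map_def val)
  moreover have "inj_on (incl E) (carrier V)"
    by (auto intro!: inj_onI simp: j_eq)
  moreover have "incl E ` carrier V = {e \<in> carrier (total E). proj E e = \<zero>\<^bsub>G\<^esub>}"
    by auto
  moreover have "proj E ` carrier (total E) = carrier G"
    by (force simp: image_iff)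
  ultimately have abelian: "abelian_extension R G D V K E"
    unfolding abelian_extension_def by (intro conjI)
  have "induces R G V \<rho> \<mu> E"
    unfolding induces_def
  proof (intro allI impI ballI)
    fix t x u
    assume t: "linear_section R G E t" and x: "x \<in> carrier G" and u: "u \<in> carrier V"
    have "t x \<in> carrier (total E)" "proj E (t x) = x"
      using t x linear_map_closed[of R G "total E" t] by (auto simp: linear_section_def)
    \<comment> \<open>An arbitrary section has values (x, w) with unknown w. Multiplying by (0, u)
      eliminates w, because the cochain, the product of G and both actions vanish at a zero
      argument.\<close>
    then obtain w where w: "w \<in> carrier V" "t x = j (x, w)"
      by auto
    then show "incl E (\<rho> x u) = t x \<otimes>\<^bsub>total E\<^esub> incl E u \<and>
        incl E (\<mu> x u) = incl E u \<otimes>\<^bsub>total E\<^esub> t x"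
      using x u by (simp add: zero)
  qed
  with abelian have "E \<in> Defs.extensions R G D V K \<rho> \<mu>"
    by (simp add: Defs.extensions_def)
  moreover have "linear_section R G E s"
    by (auto simp: linear_section_def linear_map_def s_def)
  ultimately interpret S: extension_section R G D V K \<rho> \<mu> E s
    by unfold_locales
  have "section_cochain G D V E s = (f, \<theta>)"
    by (rule S.section_cochain_eqI)
      (simp_all add: s_def val zero hom_space_2D(1)[OF f] hom_space_1D(1)[OF \<theta>, simplified])
  then show ?thesis
    using S.extension_section_axioms by blast
qed

theorem theorem5p11:
  fixes R :: "'k ring" and G :: "('k, 'g) module" and V :: "('k, 'v) module"
    and D :: "'g \<Rightarrow> 'g" and K :: "'v \<Rightarrow> 'v" and \<rho> \<mu> :: "'g \<Rightarrow> 'v \<Rightarrow> 'v"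
    and Ext :: "('k, 'u, 'g, 'v) extension set" and Iso :: "('k, 'u, 'g, 'v) extension rel"
  defines "Ext \<equiv> extensions R G D V K \<rho> \<mu>"
    and "Iso \<equiv> iso_rel R G D V K \<rho> \<mu>"
  assumes "alg_closed_field_char_0 R"
    and "regular_preLieDer R G D"
    and "preLieDer_representation R G D V K \<rho> \<mu>"
    and universe: "\<exists>j :: 'g \<times> 'v \<Rightarrow> 'u. inj_on j (carrier G \<times> carrier V)"
  shows "equiv Ext Iso \<and>
    (\<forall>E \<in> Ext. \<exists>s. linear_section R G E s) \<and>
    (\<forall>E \<in> Ext. \<forall>s. linear_section R G E s \<longrightarrow>
       section_cochain G D V E s \<in> cocycles R G D V K \<rho> \<mu> 2) \<and>
    (\<exists>\<Phi>. (\<forall>E \<in> Ext. \<forall>s. linear_section R G E s \<longrightarrow>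
              \<Phi> (Iso `` {E}) = cohomology_class R G D V K \<rho> \<mu> 2 (section_cochain G D V E s)) \<and>
          bij_betw \<Phi> (Ext // Iso) (carrier (cohomology R G D V K \<rho> \<mu> 2)))"
proof -
  note rep = \<open>preLieDer_representation R G D V K \<rho> \<mu>\<close>
  interpret preLieDer_representation R G D V K \<rho> \<mu>
    by (rule rep)
  \<comment> \<open>\<open>cls\<close> still refers to a section; \<open>sec\<close> fixes one per
    extension, and \<open>cls_sec\<close> shows that any other section gives the same class.\<close>
  define cls where
    "cls E s = cohomology_class R G D V K \<rho> \<mu> 2 (section_cochain G D V E s)"
    for E :: "('k, 'u, 'g, 'v) extension" and s
  define sec where "sec E = (SOME s. linear_section R G E s)" for E :: "('k, 'u, 'g, 'v) extension"
  have ex_section: "\<exists>s. linear_section R G E s" if "E \<in> Ext" for E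
  proof -
    have E: "regular_preLieDer R (total E) (der E)" "linear_map R (total E) G (proj E)"
      "proj E ` carrier (total E) = carrier G"
      using that by (simp_all add: Ext_def Defs.extensions_def abelian_extension_def preLieDer_hom_def)
    interpret T: regular_preLieDer R "total E" "der E"
      by (rule E(1))
    show ?thesis
      using linear_map_right_inverse[OF field_axioms T.G_module G_module E(2,3)]
      by (simp only: linear_section_def)
  qed
  have in_locale: "extension_section R G D V K \<rho> \<mu> E s"
    if "E \<in> Ext" "linear_section R G E s" for E s
    using that rep by (simp add: Ext_def extension_section_def extension_section_axioms_def)
  have sec: "linear_section R G E (sec E)" if "E \<in> Ext" for E
    unfolding sec_def using someI_ex[OF ex_section[OF that]] .
  have cls_sec: "cls E s = cls E (sec E)" if "E \<in> Ext" "linear_section R G E s" for E s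
    unfolding cls_def
    using extension_section.cohomology_class_section_independent
      [OF in_locale[OF that(1) sec[OF that(1)]] that(2)] .
  \<comment> \<open>Isomorphism becomes equality of an invariant. That \<open>Iso\<close> is an
    equivalence and that the induced map on classes is well defined and injective are then
    formal.\<close>
  have Iso_iff: "(E, F) \<in> Iso \<longleftrightarrow> E \<in> Ext \<and> F \<in> Ext \<and> cls E (sec E) = cls F (sec F)" for E F
  proof -
    have "(\<exists>\<zeta>. extension_iso R V E F \<zeta>) \<longleftrightarrow> cls E (sec E) = cls F (sec F)"
      if E: "E \<in> Ext" and F: "F \<in> Ext"
    proof
      interpret E: extension_section R G D V K \<rho> \<mu> E "sec E"
        by (rule in_locale[OF E sec[OF E]])
      interpret F: extension_section R G D V K \<rho> \<mu> F "sec F"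
        by (rule in_locale[OF F sec[OF F]])
      show "cls E (sec E) = cls F (sec F)" if iso: "\<exists>\<zeta>. extension_iso R V E F \<zeta>"
      proof -
        obtain \<zeta> where "extension_iso R V E F \<zeta>"
          using iso ..
        from E.section_cochain_iso[OF F.ext this] show ?thesis
          using cls_sec[OF F] by (metis cls_def)
      qed
      assume "cls E (sec E) = cls F (sec F)"
      then obtain \<phi> where \<phi>: "\<phi> \<in> hom_space R G V 1"
        and eq: "section_cochain G D V E (sec E) =
          coboundary1 \<phi> \<otimes>\<^bsub>cochains R G V 2\<^esub> section_cochain G D V F (sec F)"
        unfolding cls_def
          cohomology_class_eq_iff[OF E.section_cochain_in_cochains F.section_cochain_in_cochains]
        by metis
      \<comment> \<open>Shifting the section of \<open>F\<close> by \<phi> upgrades equal classes to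
        equal cochains, as \<open>extension_iso_of_cochain_eq\<close> requires.\<close>
      let ?t = "\<lambda>x. sec F x \<oplus>\<^bsub>total F\<^esub> incl F (\<phi> [x])"
      have t: "linear_section R G F ?t"
        by (rule F.shifted_section[OF \<phi>])
      show "\<exists>\<zeta>. extension_iso R V E F \<zeta>"
        using E.extension_iso_of_cochain_eq[OF in_locale[OF F t]]
          F.change_section[OF \<phi> t] eq by simp
    qed
    then show ?thesis
      by (auto simp: Iso_def iso_rel_def Ext_def)
  qed
  have equiv: "equiv Ext Iso"
    by (auto intro!: equivI refl_onI symI transI simp: Iso_iff)
  have cocycle: "section_cochain G D V E s \<in> cocycles R G D V K \<rho> \<mu> 2"
    if "E \<in> Ext" "linear_section R G E s" for E s
    by (rule extension_section.section_cochain_cocycle[OF in_locale[OF that]])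
  have onto: "\<exists>E\<in>Ext. cls E (sec E) = c" if c: "c \<in> carrier (cohomology R G D V K \<rho> \<mu> 2)" for c
  proof -
    obtain f \<theta> where f\<theta>: "(f, \<theta>) \<in> cocycles R G D V K \<rho> \<mu> 2"
      "c = cohomology_class R G D V K \<rho> \<mu> 2 (f, \<theta>)"
      using c by (auto simp: carrier_cohomology)
    obtain j :: "'g \<times> 'v \<Rightarrow> 'u" where "inj_on j (carrier G \<times> carrier V)"
      using universe by metis
    from twisted_extension_section[OF rep this f\<theta>(1)]
    obtain E :: "('k, 'u, 'g, 'v) extension" and s where
      S: "extension_section R G D V K \<rho> \<mu> E s" and eq: "section_cochain G D V E s = (f, \<theta>)"
      by metis
    have "E \<in> Ext" "linear_section R G E s"
      using extension_section.ext[OF S] extension_section.sec[OF S] by (simp_all add: Ext_def)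
    then show ?thesis
      using cls_sec eq f\<theta>(2) by (metis cls_def)
  qed
  \<comment> \<open>All members of an isomorphism class have the same \<open>cls\<close> by
    \<open>Iso_iff\<close>, so the description picks out exactly one value.\<close>
  define \<Phi> where "\<Phi> C = (THE c. \<exists>E\<in>C. c = cls E (sec E))" for C
  have \<Phi>: "\<Phi> (Iso `` {E}) = cls E (sec E)" if "E \<in> Ext" for E
    unfolding \<Phi>_def using that by (intro the_equality) (auto simp: Iso_iff)
  have "bij_betw \<Phi> (Ext // Iso) (carrier (cohomology R G D V K \<rho> \<mu> 2))"
  proof (rule bij_betw_imageI)
    show "inj_on \<Phi> (Ext // Iso)"
      by (rule inj_onI, elim quotientE) (auto simp: \<Phi> Iso_iff)
    show "\<Phi> ` (Ext // Iso) = carrier (cohomology R G D V K \<rho> \<mu> 2)"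
    proof (intro equalityI subsetI)
      fix c assume "c \<in> \<Phi> ` (Ext // Iso)"
      then obtain E where "E \<in> Ext" "c = cls E (sec E)"
        using \<Phi> by (auto elim!: quotientE)
      then show "c \<in> carrier (cohomology R G D V K \<rho> \<mu> 2)"
        using cocycle[OF _ sec] by (simp add: carrier_cohomology cls_def)
    next
      fix c assume "c \<in> carrier (cohomology R G D V K \<rho> \<mu> 2)"
      then obtain E where E: "E \<in> Ext" "cls E (sec E) = c"
        using onto by metis
      then show "c \<in> \<Phi> ` (Ext // Iso)"
        using \<Phi> quotientI[of E Ext Iso] by (metis imageI)
    qed
  qed
  moreover have "\<Phi> (Iso `` {E}) = cohomology_class R G D V K \<rho> \<mu> 2 (section_cochain G D V E s)"
    if "E \<in> Ext" "linear_section R G E s" for E s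
    using \<Phi>[OF that(1)] cls_sec[OF that] by (simp add: cls_def)
  ultimately show ?thesis
    using equiv ex_section cocycle by (intro conjI exI[of _ \<Phi>]) (simp_all only: Ball_def, simp_all)
qed

end
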